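(* Consider a queueing game with strategy simplex $\Delta\subset\mathbb{R}^k$, stationary expected utility $\mathbf{u}:\Delta\to\mathbb{R}^k$, cycle length $L(\mathbf{p})$ and cycle estimator $\mathbf{G}$ as described in the context. Suppose that: (A1) $\ell^2(\mathbf{p})=\mathrm{E}_{\mathbf{p}}[L(\mathbf{p})^2]<\infty$ for all $\mathbf{p}\in\Delta$; (A2) $\sup_{\mathbf{p}\in\Delta}\mathrm{E}_{\mathbf{p}}\Vert\mathbf{G}\Vert^2<\infty$; (A3) $\mathbf{H}\mathbf{u}(\cdot)$ is continuous on $\Delta$, and there exists a differentiable function $u^*:\Delta\to\mathbb{R}$ such that $-\mathbf{H}\mathbf{u}(\mathbf{p})=\nabla u^*(\mathbf{p})$ for all $\mathbf{p}\in\Delta$. Suppose also that $\mathbf{u}$ is (locally) Lipschitz on $\Delta$, and that $u^*$ is strongly convex on $\Delta$, i.e., there exists a constant $C>0$ such that $$u^*(\mathbf{p})\ge u^*(\mathbf{q})-\mathbf{H}\mathbf{u}(\mathbf{q})'(\mathbf{p}-\mathbf{q})+\frac{C}{2}\Vert\mathbf{p}-\mathbf{q}\Vert^2,\qquad\forall\,\mathbf{p},\mathbf{q}\in\Delta.$$ Let $\gamma_n=\eta/n$, where $\eta>1/(2C)$, let $\mathbf{p}^{(1)}\in\Delta$, and let $\mathbf{p}^{(n+1)}=\pi_\Delta\big(\mathbf{p}^{(n)}+\gamma_n\mathbf{G}^{(n)}\big)$, $n\ge1$. Then there exists a constant $M$ such that for all $n\ge1$ and $\delta\in(0,1)$, $$\mathrm{P}\Big(\mathbf{u}(\mathbf{p}^{(n)})'\mathbf{p}^{(n)}\ge\max_{\mathbf{q}\in\Delta}\mathbf{u}(\mathbf{p}^{(n)})'\mathbf{q}-\sqrt{n^{-\delta}}\Big)\ge1-M\cdot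 n^{\delta-1};$$ that is, for all $n$ and $\delta\in(0,1)$, the $n$-th iterate $\mathbf{p}^{(n)}$ is a $\sqrt{n^{-\delta}}$-equilibrium with probability at least $1-M\cdot n^{\delta-1}$.
   Context: Notation: $k\ge2$; $\Delta=\{\mathbf{p}\in\mathbb{R}^k: p_i\ge0,\ \sum_i p_i=1\}$; $\Vert\cdot\Vert$ is the Euclidean norm; $\pi_\Delta$ is the Euclidean projection onto $\Delta$; $'$ denotes transpose; $\mathbf{e}$ is the all-ones vector; $\mathbf{H}\in\mathbb{R}^{k\times k}$ is the matrix of the orthogonal projection onto $\mathcal{H}=\{\mathbf{x}\in\mathbb{R}^k:\mathbf{e}'\mathbf{x}=0\}$. The gradient of a function $u^*:\Delta\to\mathbb{R}$ is taken relative to the affine hull of $\Delta$: $\nabla u^*(\mathbf{p})\in\mathcal{H}$ and $u^*(\mathbf{q})=u^*(\mathbf{p})+\nabla u^*(\mathbf{p})'(\mathbf{q}-\mathbf{p})+o(\Vert\mathbf{q}-\mathbf{p}\Vert)$ for $\mathbf{q}\in\Delta$, $\mathbf{q}\to\mathbf{p}$. Queueing game: customers arrive at a service system according to a renewal process with arrival epochs $T_1<T_2<\dots$ (i.i.d. inter-arrival times). Each arriving customer chooses one of $k$ actions $a_1,\dots,a_k$; a strategy $\mathbf{p}\in\Delta$ assigns probability $p_i$ to $a_i$. When all customers use $\mathbf{p}$, the system state is a process $X(t;\mathbf{p})$, right-continuous with left limits, with values in $\mathcal{X}\subset\mathbb{R}^d_+$, $0^d\in\mathcal{X}$. Put $X_n(\mathbf{p})=X(T_n-;\mathbf{p})$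 (state just before the $n$-th arrival), with $X_1(\mathbf{p})=0^d$; $\mathrm{E}_{\mathbf{p}}$ is expectation under strategy $\mathbf{p}$. State $0^d$ is regenerative for $\{X_n(\mathbf{p})\}_n$: the process starts afresh whenever $X_n(\mathbf{p})=0^d$, and successive cycles are i.i.d. The cycle length is $L(\mathbf{p})=\inf\{n\ge1: X_{n+1}(\mathbf{p})=0^d\}$, and $\ell^r(\mathbf{p})=\mathrm{E}_{\mathbf{p}}[L(\mathbf{p})^r]$. It is assumed that for every $\mathbf{p}\in\Delta$ a stationary distribution exists, with $X(\mathbf{p})$ denoting a random variable having the stationary distribution at arrival epochs ($X_n(\mathbf{p})\to X(\mathbf{p})$ in distribution). Utility: action $a_i$ taken at state $x$ with random outcome $y$ has value $v_i(x,y)$; $\mathbf{v}=(v_1,\dots,v_k)$. The distribution of the outcome $Y$ may depend on the state (and on $\mathbf{p}$, as may $\mathbf{v}$; this dependence is suppressed). Let $\overline{\mathbf{v}}(X)=\mathrm{E}_Y[\mathbf{v}(X,Y)\mid X]$, assumed integrable with respect to the law of $X(\mathbf{p})$ for every $\mathbf{p}$, and $\mathbf{u}(\mathbf{p})=\mathrm{E}_{\mathbf{p}}[\mathbf{v}(X(\mathbf{p}),Y)]=\mathrm{E}_{\mathbf{p}}[\overline{\mathbf{v}}(X(\mathbf{p}))]\in\mathbb{R}^k$. Approximate equilibrium: for $\epsilon\ge 0$, $\mathbf{p}\in\Delta$ is an $\epsilon$-equilibrium if $\mathbf{u}(\mathbf{p})'\mathbf{p}\ge\max_{\mathbf{q}\in\Delta}\mathbf{u}(\mathbf{p})'\mathbf{q}-\epsilon$.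 Estimator and algorithm: under $\mathbf{p}$, $\mathbf{G}=\sum_{j=1}^{L}\overline{\mathbf{v}}(X_j)$, where $X_1=0^d,X_2,\dots,X_L$ are the states seen by the arrivals of a single regenerative cycle with $L=L(\mathbf{p})$. In the algorithm, $\mathbf{G}^{(n)}$ is computed from a newly simulated cycle under strategy $\mathbf{p}^{(n)}$: conditionally on the past of the algorithm up to and including $\mathbf{p}^{(n)}$, $\mathbf{G}^{(n)}$ is distributed as $\mathbf{G}$ under strategy $\mathbf{p}^{(n)}$. *)

theory Defs
  imports "HOL-Probability.Probability"
begin

section \<open>The strategy simplex\<close>

definition strategies :: "(real ^ 'k) set" where
  "strategies = {p. (\<forall>i. 0 \<le> p $ i) \<and> (\<Sum>i\<in>UNIV. p $ i) = 1}"

definition ones :: "real ^ 'k" where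
  "ones = (\<chi> i. 1)"

definition tangent_space :: "(real ^ 'k) set" where
  "tangent_space = {x. ones \<bullet> x = 0}"

text \<open>
  The matrix of the orthogonal projection onto \<open>tangent_space\<close>; for a linear subspace the
  nearest-point map is the orthogonal projection, and \<open>matrix\<close> reads off its columns.
\<close>

definition tangent_proj :: "real ^ 'k ^ 'k" where
  "tangent_proj = matrix (closest_point tangent_space)"

text \<open>
  \<open>g\<close> is the gradient of \<open>f\<close> at \<open>p\<close> relative to the affine hull of the simplex. The derivative is
  taken within the simplex, so the remainder is controlled only for points of the simplex; the
  condition that \<open>g\<close> is tangent makes it unique.
\<close>

definition has_simplex_gradient ::
    "(real ^ 'k \<Rightarrow> real) \<Rightarrow> real ^ 'k \<Rightarrow> real ^ 'k \<Rightarrow> bool" where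
  "has_simplex_gradient f p g \<longleftrightarrow>
     g \<in> tangent_space \<and> (f has_derivative (\<lambda>h. g \<bullet> h)) (at p within strategies)"

definition locally_lipschitz_on ::
    "'a::metric_space set \<Rightarrow> ('a \<Rightarrow> 'b::metric_space) \<Rightarrow> bool" where
  "locally_lipschitz_on S f \<longleftrightarrow>
     (\<forall>x\<in>S. \<exists>r>0. \<exists>K. lipschitz_on K (cball x r \<inter> S) f)"

section \<open>The queueing game\<close>

text \<open>
  The data of a queueing game. Expectation under strategy \<open>p\<close> is expectation with respect to
  \<open>strat_prob G p\<close>; \<open>state_proc G p t w\<close> is the system state at time \<open>t \<ge> 0\<close> when all customers
  use \<open>p\<close>. Arrivals and customers are numbered from 1. Given that an arrival finds state \<open>x\<close>, the
  outcome has law \<open>outcome_law G p x\<close>, and \<open>outcome_val G p x y\<close> is the vector of the values of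
  the \<open>k\<close> actions. \<open>stat_law G p\<close> is the law of the stationary state at arrival epochs.
\<close>

record ('w, 'k::finite, 'd::finite, 'y) game_data =
  state_set :: "(real ^ 'd) set"
  gap_law :: "real measure"
  strat_prob :: "real ^ 'k \<Rightarrow> 'w measure"
  arrival :: "nat \<Rightarrow> 'w \<Rightarrow> real"
  action :: "nat \<Rightarrow> 'w \<Rightarrow> 'k"
  state_proc :: "real ^ 'k \<Rightarrow> real \<Rightarrow> 'w \<Rightarrow> real ^ 'd"
  outcome_space :: "'y measure"
  outcome_law :: "real ^ 'k \<Rightarrow> real ^ 'd \<Rightarrow> 'y measure"
  outcome_val :: "real ^ 'k \<Rightarrow> real ^ 'd \<Rightarrow> 'y \<Rightarrow> real ^ 'k"
  stat_law :: "real ^ 'k \<Rightarrow> (real ^ 'd) measure"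

definition state_algebra :: "('w, 'k::finite, 'd::finite, 'y) game_data \<Rightarrow> (real ^ 'd) measure" where
  "state_algebra \<G> = restrict_space borel (state_set \<G>)"

definition pre_arrival ::
    "('w, 'k::finite, 'd::finite, 'y) game_data \<Rightarrow> real ^ 'k \<Rightarrow> nat \<Rightarrow> 'w \<Rightarrow> real ^ 'd" where
  "pre_arrival \<G> p n \<omega> = Lim (at_left (arrival \<G> n \<omega>)) (\<lambda>t. state_proc \<G> p t \<omega>)"

definition cycle_length ::
    "('w, 'k::finite, 'd::finite, 'y) game_data \<Rightarrow> real ^ 'k \<Rightarrow> 'w \<Rightarrow> enat" where
  "cycle_length \<G> p \<omega> = (INF n\<in>{n. 1 \<le> n \<and> pre_arrival \<G> p (n + 1) \<omega> = 0}. enat n)"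

definition cycle_moment ::
    "nat \<Rightarrow> ('w, 'k::finite, 'd::finite, 'y) game_data \<Rightarrow> real ^ 'k \<Rightarrow> ennreal" where
  "cycle_moment r \<G> p =
     (\<integral>\<^sup>+ \<omega>. (ennreal_of_enat (cycle_length \<G> p \<omega>)) ^ r \<partial>strat_prob \<G> p)"

definition mean_val ::
    "('w, 'k::finite, 'd::finite, 'y) game_data \<Rightarrow> real ^ 'k \<Rightarrow> real ^ 'd \<Rightarrow> real ^ 'k" where
  "mean_val \<G> p x = (LINT y|outcome_law \<G> p x. outcome_val \<G> p x y)"

definition utility :: "('w, 'k::finite, 'd::finite, 'y) game_data \<Rightarrow> real ^ 'k \<Rightarrow> real ^ 'k" where
  "utility \<G> p = (LINT x|stat_law \<G> p. mean_val \<G> p x)"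

text \<open>
  The index set of the sum is infinite, and the sum is then 0 by convention, only where the cycle
  length is infinite.
\<close>

definition cycle_estimator ::
    "('w, 'k::finite, 'd::finite, 'y) game_data \<Rightarrow> real ^ 'k \<Rightarrow> 'w \<Rightarrow> real ^ 'k" where
  "cycle_estimator \<G> p \<omega> =
     (\<Sum>j\<in>{j. 1 \<le> j \<and> enat j \<le> cycle_length \<G> p \<omega>}. mean_val \<G> p (pre_arrival \<G> p j \<omega>))"

text \<open>
  Regeneration at state 0: whenever \<open>Z\<^sub>m = 0\<close>, the sequence from index \<open>m\<close> on is independent of
  the past \<open>Z\<^sub>1, \<dots>, Z\<^sub>m\<close> and distributed as the sequence started at index 1. In particular the
  successive cycles between visits to 0 are independent and identically distributed.
\<close>

definition regenerative_at_zero ::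
    "'w measure \<Rightarrow> (nat \<Rightarrow> 'w \<Rightarrow> 'e::{topological_space, zero}) \<Rightarrow> bool" where
  "regenerative_at_zero M Z \<longleftrightarrow>
     (\<forall>m\<ge>1. \<forall>A\<in>sets (Pi\<^sub>M {1..m} (\<lambda>_. borel)). \<forall>B\<in>sets (Pi\<^sub>M UNIV (\<lambda>_. borel)).
        measure M {\<omega>\<in>space M. (\<lambda>j\<in>{1..m}. Z j \<omega>) \<in> A \<and> Z m \<omega> = 0 \<and> (\<lambda>j. Z (m + j) \<omega>) \<in> B} =
        measure M {\<omega>\<in>space M. (\<lambda>j\<in>{1..m}. Z j \<omega>) \<in> A \<and> Z m \<omega> = 0} *
        measure M {\<omega>\<in>space M. (\<lambda>j. Z (1 + j) \<omega>) \<in> B})"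

text \<open>
  The assumptions on the arrivals concern the inter-arrival times \<open>T\<^sub>2 - T\<^sub>1, T\<^sub>3 - T\<^sub>2, \<dots>\<close>; the law of
  \<open>T\<^sub>1\<close> is left free, so that delayed renewal processes are included.
  Left limits are required to exist in the state set. Convergence in distribution to the
  stationary law is tested on bounded continuous functions on the state set.
\<close>

locale queueing_game =
  fixes \<G> :: "('w, 'k::finite, 'd::finite, 'y) game_data"
  assumes states_nonneg: "x \<in> state_set \<G> \<Longrightarrow> \<forall>j. 0 \<le> x $ j"
    and zero_state: "0 \<in> state_set \<G>"
    and prob: "p \<in> strategies \<Longrightarrow> prob_space (strat_prob \<G> p)"
    and arrival_measurable:
      "p \<in> strategies \<Longrightarrow> 1 \<le> n \<Longrightarrow> arrival \<G> n \<in> borel_measurable (strat_prob \<G> p)"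
    and arrival_pos:
      "p \<in> strategies \<Longrightarrow> \<omega> \<in> space (strat_prob \<G> p) \<Longrightarrow> 0 < arrival \<G> 1 \<omega>"
    and arrival_less:
      "p \<in> strategies \<Longrightarrow> \<omega> \<in> space (strat_prob \<G> p) \<Longrightarrow> 1 \<le> n \<Longrightarrow>
         arrival \<G> n \<omega> < arrival \<G> (n + 1) \<omega>"
    and gaps_indep:
      "p \<in> strategies \<Longrightarrow>
         prob_space.indep_vars (strat_prob \<G> p) (\<lambda>_. borel)
           (\<lambda>n \<omega>. arrival \<G> (n + 1) \<omega> - arrival \<G> n \<omega>) {1..}"
    and gaps_law:
      "p \<in> strategies \<Longrightarrow> 1 \<le> n \<Longrightarrow>
         distr (strat_prob \<G> p) borel (\<lambda>\<omega>. arrival \<G> (n + 1) \<omega> - arrival \<G> n \<omega>) = gap_law \<G>"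
    and action_measurable:
      "p \<in> strategies \<Longrightarrow> 1 \<le> n \<Longrightarrow>
         action \<G> n \<in> measurable (strat_prob \<G> p) (count_space UNIV)"
    and action_prob:
      "p \<in> strategies \<Longrightarrow> 1 \<le> n \<Longrightarrow>
         measure (strat_prob \<G> p) {\<omega>\<in>space (strat_prob \<G> p). action \<G> n \<omega> = i} = p $ i"
    and state_measurable:
      "p \<in> strategies \<Longrightarrow> 0 \<le> t \<Longrightarrow>
         state_proc \<G> p t \<in> measurable (strat_prob \<G> p) (state_algebra \<G>)"
    and state_right_cont:
      "p \<in> strategies \<Longrightarrow> \<omega> \<in> space (strat_prob \<G> p) \<Longrightarrow> 0 \<le> t \<Longrightarrow>
         continuous (at_right t) (\<lambda>s. state_proc \<G> p s \<omega>)"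
    and state_left_limit:
      "p \<in> strategies \<Longrightarrow> \<omega> \<in> space (strat_prob \<G> p) \<Longrightarrow> 0 < t \<Longrightarrow>
         \<exists>l\<in>state_set \<G>. ((\<lambda>s. state_proc \<G> p s \<omega>) \<longlongrightarrow> l) (at_left t)"
    and starts_empty:
      "p \<in> strategies \<Longrightarrow> \<omega> \<in> space (strat_prob \<G> p) \<Longrightarrow> pre_arrival \<G> p 1 \<omega> = 0"
    and regenerative:
      "p \<in> strategies \<Longrightarrow> regenerative_at_zero (strat_prob \<G> p) (pre_arrival \<G> p)"
    and stat_prob: "p \<in> strategies \<Longrightarrow> prob_space (stat_law \<G> p)"
    and stat_sets: "p \<in> strategies \<Longrightarrow> sets (stat_law \<G> p) = sets (state_algebra \<G>)"
    and stat_limit: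
      "p \<in> strategies \<Longrightarrow> continuous_on (state_set \<G>) f \<Longrightarrow> bounded (f ` state_set \<G>) \<Longrightarrow>
         (\<lambda>n. LINT \<omega>|strat_prob \<G> p. f (pre_arrival \<G> p n \<omega>))
           \<longlonglongrightarrow> (LINT x|stat_law \<G> p. (f x :: real))"
    and outcome_kernel:
      "p \<in> strategies \<Longrightarrow>
         outcome_law \<G> p \<in> measurable (state_algebra \<G>) (prob_algebra (outcome_space \<G>))"
    and val_measurable:
      "p \<in> strategies \<Longrightarrow>
         (\<lambda>(x, y). outcome_val \<G> p x y)
           \<in> borel_measurable (state_algebra \<G> \<Otimes>\<^sub>M outcome_space \<G>)"
    and val_integrable:
      "p \<in> strategies \<Longrightarrow>
         AE x in stat_law \<G> p. integrable (outcome_law \<G> p x) (outcome_val \<G> p x)"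
    and mean_val_integrable:
      "p \<in> strategies \<Longrightarrow> integrable (stat_law \<G> p) (mean_val \<G> p)"

text \<open>The supremum is over a compact set and is attained, so it is a maximum.\<close>

definition eps_equilibrium ::
    "(real ^ 'k \<Rightarrow> real ^ 'k) \<Rightarrow> real \<Rightarrow> real ^ 'k \<Rightarrow> bool" where
  "eps_equilibrium u \<epsilon> p \<longleftrightarrow>
     p \<in> strategies \<and> u p \<bullet> p \<ge> (SUP q\<in>strategies. u p \<bullet> q) - \<epsilon>"

section \<open>The stochastic approximation algorithm\<close>

text \<open>The sigma-algebra generated by \<open>P\<^sub>1, E\<^sub>1, P\<^sub>2, \<dots>, E\<^sub>n\<^sub>-\<^sub>1, P\<^sub>n\<close>.\<close>

definition past ::
    "'s measure \<Rightarrow> (nat \<Rightarrow> 's \<Rightarrow> 'e::topological_space) \<Rightarrow> (nat \<Rightarrow> 's \<Rightarrow> 'e) \<Rightarrow> nat \<Rightarrow> 's measure" where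
  "past M P E n = sigma (space M)
     ({P i -` A \<inter> space M | i A. i \<in> {1..n} \<and> A \<in> sets borel} \<union>
      {E i -` A \<inter> space M | i A. i \<in> {1..<n} \<and> A \<in> sets borel})"

text \<open>Conditionally on \<open>F\<close>, the random variable \<open>Z\<close> has the random law \<open>\<kappa>\<close>.\<close>

definition has_cond_law ::
    "'s measure \<Rightarrow> 's measure \<Rightarrow> ('s \<Rightarrow> 'e::topological_space) \<Rightarrow> ('s \<Rightarrow> 'e measure) \<Rightarrow> bool" where
  "has_cond_law M F Z \<kappa> \<longleftrightarrow>
     (\<forall>B\<in>sets borel. AE s in M.
        real_cond_exp M F (\<lambda>s. indicator B (Z s)) s = measure (\<kappa> s) B)"

end

theory Submission
  imports Defs
begin

text \<open>
  The algorithm is a projected stochastic gradient descent on the strongly convex potential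
  \<open>ustar\<close>, and the classical rate for such schemes applies: the mean squared distance to the
  minimiser \<open>p\<close> is of order \<open>1 / n\<close>. What makes it a gradient descent is the renewal-reward theorem.

  Renewal theory. Decomposing according to the last visit to the empty state shows that the long-run
  frequency of a set of states is the expected time that one cycle spends in it, divided by the mean
  cycle length \<open>c\<close>. The states also converge weakly to the stationary law, so the occupation measure
  of a cycle is \<open>c\<close> times the stationary law (\<open>occupation_eq_stationary\<close>). Integrating the conditional
  mean of the values against it, the cycle estimator has mean \<open>c *\<^sub>R utility \<G> q\<close> with \<open>c \<ge> 1\<close>
  (\<open>cycle_estimator_mean\<close>).

  Drift. Strong convexity gives \<open>u q \<bullet> (q - p) \<le> - C * (norm (q - p))\<^sup>2\<close> for every strategy \<open>q\<close>
  (\<open>potential_minimiser_exists\<close>), and multiplying the left-hand side by \<open>c \<ge> 1\<close> keeps this bound.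
  Conditioning on the past (\<open>nn_integral_cond_law\<close>) and expanding the square
  (\<open>noisy_step_second_moment\<close>), the mean squared distances \<open>r n\<close> satisfy
  \<open>r (n + 1) \<le> (1 - 2 * C * \<eta> / n) * r n + \<eta>\<^sup>2 * V / n\<^sup>2\<close>, where \<open>V\<close> bounds the second moments of
  the estimators. Since \<open>2 * C * \<eta> > 1\<close>, this forces \<open>r n \<le> D / n\<close> (\<open>decay_of_recursion\<close>).

  Conclusion. The strategy \<open>p\<close> is an equilibrium and the utility is locally Lipschitz on a compact
  set, so the regret of \<open>q\<close> is at most \<open>L * norm (q - p)\<close> (\<open>regret_le_distance\<close>). Markov's inequality for the squared distance
  bounds the probability that the regret exceeds \<open>sqrt (n powr - \<delta>)\<close> by \<open>L\<^sup>2 * D * n powr (\<delta> - 1)\<close>.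
\<close>

section \<open>Renewal averages\<close>

lemma cesaro_mean:
  fixes X :: "nat \<Rightarrow> real"
  assumes "X \<longlonglongrightarrow> L"
  shows "(\<lambda>N. (\<Sum>n<N. X n) / real N) \<longlonglongrightarrow> L"
proof (rule LIMSEQ_I)
  fix r :: real assume r: "0 < r"
  obtain N0 where N0: "\<And>n. n \<ge> N0 \<Longrightarrow> norm (X n - L) < r / 2"
    using LIMSEQ_D[OF assms, of "r/2"] r by auto
  define S where "S = (\<Sum>n<N0. norm (X n - L))"
  have S0: "0 \<le> S" unfolding S_def by (simp add: sum_nonneg)
  obtain N1 :: nat where N1: "real N1 > 2 * S / r" using reals_Archimedean2 by blast
  show "\<exists>no. \<forall>n\<ge>no. norm ((\<Sum>i<n. X i) / real n - L) < r"
  proof (intro exI[of _ "max 1 (max N0 N1)"] allI impI)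
    fix n assume n: "max 1 (max N0 N1) \<le> n"
    then have npos: "real n > 0" by simp
    have "norm ((\<Sum>i<n. X i) / real n - L) = norm (\<Sum>i<n. X i - L) / real n"
    proof -
      have "(\<Sum>i<n. X i) / real n - L = (\<Sum>i<n. X i - L) / real n"
        using npos by (simp add: sum_subtractf field_simps)
      then show ?thesis using npos by simp
    qed
    also have "norm (\<Sum>i<n. X i - L) \<le> (\<Sum>i<n. norm (X i - L))"
      by (rule norm_sum)
    also have "\<dots> = S + (\<Sum>i=N0..<n. norm (X i - L))"
      unfolding S_def lessThan_atLeast0 using n
      by (subst sum.atLeastLessThan_concat) auto
    also have "(\<Sum>i=N0..<n. norm (X i - L)) \<le> (\<Sum>i=N0..<n. r / 2)"
      by (rule sum_mono) (use N0 in \<open>auto intro: less_imp_le\<close>)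
    also have "(\<Sum>i=N0..<n. r / 2) \<le> real n * (r / 2)"
      using n r by (simp add: mult_right_mono)
    finally have "norm ((\<Sum>i<n. X i) / real n - L) \<le> (S + real n * (r / 2)) / real n"
      using npos by (simp add: divide_right_mono)
    also have "\<dots> = S / real n + r / 2" using npos by (simp add: field_simps)
    also have "S / real n < r / 2"
    proof -
      have "2 * S / r < real n" using N1 n by linarith
      then show ?thesis using r npos by (simp add: field_simps)
    qed
    finally show "norm ((\<Sum>i<n. X i) / real n - L) < r" by simp
  qed
qed

text \<open>
  Summing the convolution over \<open>n < N\<close> gives \<open>\<Sum>m<N. u m * C (N - m)\<close> with \<open>C\<close> the partial sums of
  \<open>c\<close>. Replacing each \<open>C (N - m)\<close> by its limit \<open>H\<close> costs at most the sum of the first \<open>N\<close> tails of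
  the series, which is \<open>o(N)\<close> by Cesaro.
\<close>

lemma convolution_average:
  fixes u c :: "nat \<Rightarrow> real"
  assumes u: "\<And>n. 0 \<le> u n" "\<And>n. u n \<le> 1" and c: "\<And>n. 0 \<le> c n" and H: "c sums H"
  shows "(\<lambda>N. H * ((\<Sum>m<N. u m) / real N) - (\<Sum>n<N. \<Sum>m\<le>n. u m * c (n - m)) / real N)
           \<longlonglongrightarrow> 0"
proof -
  define C where "C j = (\<Sum>i<j. c i)" for j
  have S: "(\<Sum>n<N. \<Sum>m\<le>n. u m * c (n - m)) = (\<Sum>m<N. u m * C (N - m))" for N
  proof (induction N)
    case (Suc N)
    have "(\<Sum>m<Suc N. u m * C (Suc N - m)) = (\<Sum>m\<le>N. u m * C (N - m) + u m * c (N - m))"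
      unfolding lessThan_Suc_atMost by (rule sum.cong) (auto simp: C_def Suc_diff_le algebra_simps)
    also have "\<dots> = (\<Sum>m\<le>N. u m * C (N - m)) + (\<Sum>m\<le>N. u m * c (N - m))"
      by (rule sum.distrib)
    also have "(\<Sum>m\<le>N. u m * C (N - m)) = (\<Sum>m<N. u m * C (N - m))"
      unfolding lessThan_Suc_atMost[symmetric] by (simp add: C_def)
    finally show ?case using Suc by simp
  qed simp
  have CH: "C j \<le> H" for j
    unfolding C_def using H c sum_le_suminf[of c "{..<j}"] by (simp add: sums_iff)
  have "(\<lambda>j. H - C j) \<longlonglongrightarrow> H - H"
    using H unfolding sums_def C_def by (intro tendsto_intros)
  then have "(\<lambda>j. H - C (Suc j)) \<longlonglongrightarrow> 0"
    by (auto dest: LIMSEQ_Suc)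
  from cesaro_mean[OF this] have lim: "(\<lambda>N. (\<Sum>n<N. H - C (Suc n)) / real N) \<longlonglongrightarrow> 0" .
  have eq: "H * (\<Sum>m<N. u m) - (\<Sum>m<N. u m * C (N - m)) = (\<Sum>m<N. u m * (H - C (N - m)))" for N
    by (simp add: sum_subtractf sum_distrib_left algebra_simps)
  have lo: "0 \<le> (\<Sum>m<N. u m * (H - C (N - m)))" for N
    using u CH by (intro sum_nonneg mult_nonneg_nonneg) auto
  have hi: "(\<Sum>m<N. u m * (H - C (N - m))) \<le> (\<Sum>n<N. H - C (Suc n))" for N
  proof -
    have "(\<Sum>m<N. u m * (H - C (N - m))) \<le> (\<Sum>m<N. H - C (Suc (N - Suc m)))"
    proof (rule sum_mono)
      fix m assume "m \<in> {..<N}"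
      then have "Suc (N - Suc m) = N - m" by auto
      moreover have "u m * (H - C (N - m)) \<le> 1 * (H - C (N - m))"
        using u CH by (intro mult_right_mono) auto
      ultimately show "u m * (H - C (N - m)) \<le> H - C (Suc (N - Suc m))" by simp
    qed
    also have "\<dots> = (\<Sum>n<N. H - C (Suc n))" by (rule sum.nat_diff_reindex)
    finally show ?thesis .
  qed
  have *: "H * ((\<Sum>m<N. u m) / real N) - (\<Sum>n<N. \<Sum>m\<le>n. u m * c (n - m)) / real N
        = (\<Sum>m<N. u m * (H - C (N - m))) / real N" for N
    unfolding S eq[symmetric] by (simp add: diff_divide_distrib)
  show ?thesis unfolding *
    by (rule tendsto_sandwich[OF _ _ tendsto_const lim])
       (auto intro!: always_eventually divide_nonneg_nonneg lo divide_right_mono hi)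
qed

text \<open>
  The elementary renewal theorem. Here \<open>u m\<close> is the probability of a renewal at time \<open>m\<close> and \<open>b i\<close>
  the probability that a cycle is still running at age \<open>i\<close>; the identity \<open>total\<close> says that some
  renewal was the last one. It forces the averages of \<open>u\<close> to tend to \<open>1 / l\<close>.
\<close>

lemma renewal_average:
  fixes u b c :: "nat \<Rightarrow> real"
  assumes u: "\<And>n. 0 \<le> u n" "\<And>n. u n \<le> 1" and b: "\<And>n. 0 \<le> b n" and l: "b sums l"
    and c: "\<And>n. 0 \<le> c n" and H: "c sums H" and "0 < l"
    and total: "\<And>n. (\<Sum>m\<le>n. u m * b (n - m)) = 1"
  shows "(\<lambda>N. (\<Sum>n<N. \<Sum>m\<le>n. u m * c (n - m)) / real N) \<longlonglongrightarrow> H / l"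
proof -
  let ?U = "\<lambda>N. (\<Sum>m<N. u m) / real N"
  have one: "eventually (\<lambda>N. (\<Sum>n<N. \<Sum>m\<le>n. u m * b (n - m)) / real N = 1) sequentially"
    unfolding total by (rule eventually_sequentiallyI[of 1]) simp
  have "(\<lambda>N. l * ?U N - (\<Sum>n<N. \<Sum>m\<le>n. u m * b (n - m)) / real N
      + (\<Sum>n<N. \<Sum>m\<le>n. u m * b (n - m)) / real N) \<longlonglongrightarrow> 0 + 1"
    by (intro tendsto_add convolution_average u b l tendsto_eventually one)
  then have "(\<lambda>N. l * ?U N / l) \<longlonglongrightarrow> 1 / l" using \<open>0 < l\<close> by (intro tendsto_divide) auto
  then have U: "?U \<longlonglongrightarrow> 1 / l" using \<open>0 < l\<close> by simp
  have "(\<lambda>N. H * ?U N - (H * ?U N - (\<Sum>n<N. \<Sum>m\<le>n. u m * c (n - m)) / real N))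
      \<longlonglongrightarrow> H * (1 / l) - 0"
    by (intro tendsto_diff convolution_average u c H tendsto_mult tendsto_const U)
  then show ?thesis by simp
qed

section \<open>Regenerative sequences\<close>

text \<open>
  Inner regularity extends the inequality from compact sets to all Borel sets; applied to a
  complement, it reverses because the total masses agree.
\<close>

lemma measure_eq_of_compact_le:
  fixes \<mu> \<nu> :: "'a::{second_countable_topology, complete_space} measure"
  assumes sets: "sets \<mu> = sets borel" "sets \<nu> = sets borel"
    and fin: "finite_measure \<mu>" "finite_measure \<nu>"
    and le: "\<And>K. compact K \<Longrightarrow> emeasure \<mu> K \<le> emeasure \<nu> K"
    and total: "emeasure \<mu> UNIV = emeasure \<nu> UNIV"
  shows "\<mu> = \<nu>"
proof (rule measure_eqI)
  interpret \<mu>: finite_measure \<mu> by fact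
  interpret \<nu>: finite_measure \<nu> by fact
  have space: "space \<mu> = UNIV" "space \<nu> = UNIV"
    using sets sets_eq_imp_space_eq[of \<mu> borel] sets_eq_imp_space_eq[of \<nu> borel] by auto
  have le': "emeasure \<mu> B \<le> emeasure \<nu> B" if B: "B \<in> sets borel" for B
    unfolding inner_regular[OF sets(1) _ B, simplified]
  proof (rule SUP_least)
    fix K assume "K \<in> {K. K \<subseteq> B \<and> compact K}"
    then show "emeasure \<mu> K \<le> emeasure \<nu> B"
      using le[of K] emeasure_mono[of K B \<nu>] B sets by (auto intro: order_trans)
  qed
  show "emeasure \<mu> A = emeasure \<nu> A" if A: "A \<in> sets \<mu>" for A
  proof (rule antisym)
    show "emeasure \<mu> A \<le> emeasure \<nu> A" using le' A sets by simp
    have A': "A \<in> sets \<nu>" "- A \<in> sets \<mu>" "- A \<in> sets \<nu>" "- A \<in> sets borel"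
      using A sets by (auto simp: Compl_eq_Diff_UNIV)
    have "measure \<mu> (- A) \<le> measure \<nu> (- A)"
      using le'[OF A'(4)] by (simp add: \<mu>.emeasure_eq_measure \<nu>.emeasure_eq_measure)
    moreover have "measure \<mu> (- A) = measure \<mu> UNIV - measure \<mu> A"
      using \<mu>.finite_measure_compl[OF A] space by (simp add: Compl_eq_Diff_UNIV)
    moreover have "measure \<nu> (- A) = measure \<nu> UNIV - measure \<nu> A"
      using \<nu>.finite_measure_compl[OF A'(1)] space by (simp add: Compl_eq_Diff_UNIV)
    moreover have "measure \<mu> UNIV = measure \<nu> UNIV" using total by (simp add: measure_def)
    ultimately have "measure \<nu> A \<le> measure \<mu> A" by simp
    then show "emeasure \<nu> A \<le> emeasure \<mu> A"
      by (simp add: \<mu>.emeasure_eq_measure \<nu>.emeasure_eq_measure)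
  qed
qed (use sets in simp)

text \<open>
  A process that starts afresh at each visit to 0. The state space is an arbitrary set with the
  trace of the Borel sets, so that the law of a state is not a priori a Borel measure.
\<close>

locale regenerative_sequence = prob_space N for N :: "'w measure" +
  fixes S :: "'e::euclidean_space set" and Z :: "nat \<Rightarrow> 'w \<Rightarrow> 'e"
  assumes Z_measurable: "1 \<le> n \<Longrightarrow> Z n \<in> measurable N (restrict_space borel S)"
    and Z_start: "\<omega> \<in> space N \<Longrightarrow> Z 1 \<omega> = 0"
    and regenerative: "regenerative_at_zero N Z"
begin

definition return_time :: "'w \<Rightarrow> enat" where
  "return_time \<omega> = (INF n\<in>{n. 1 \<le> n \<and> Z (n + 1) \<omega> = 0}. enat n)"

lemma less_return_time_iff: "enat i < return_time \<omega> \<longleftrightarrow> (\<forall>j\<in>{1..i}. Z (Suc j) \<omega> \<noteq> 0)"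
proof -
  have "enat i < return_time \<omega> \<longleftrightarrow> enat (Suc i) \<le> return_time \<omega>" by (simp add: Suc_ile_eq)
  also have "\<dots> \<longleftrightarrow> (\<forall>n. 1 \<le> n \<and> Z (n + 1) \<omega> = 0 \<longrightarrow> Suc i \<le> n)"
    by (simp add: return_time_def le_INF_iff)
  also have "\<dots> \<longleftrightarrow> (\<forall>j\<in>{1..i}. Z (Suc j) \<omega> \<noteq> 0)"
    by (auto simp: not_le less_eq_Suc_le)
  finally show ?thesis .
qed

lemma cycle_pos: "enat 0 < return_time \<omega>"
  by (simp add: less_return_time_iff)

lemma Z_borel [measurable]: "1 \<le> n \<Longrightarrow> Z n \<in> borel_measurable N"
  using Z_measurable by (simp add: measurable_restrict_space2_iff)

lemma Z_Suc_borel [measurable]: "Z (Suc n) \<in> borel_measurable N"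
  by (rule Z_borel) simp

lemma Z_Suc_restrict [measurable]: "Z (Suc n) \<in> measurable N (restrict_space borel S)"
  by (rule Z_measurable) simp

lemma pred_less_return_time [measurable (raw)]: "Measurable.pred N (\<lambda>\<omega>. enat i < return_time \<omega>)"
  unfolding less_return_time_iff by measurable

lemma return_time_measurable: "return_time \<in> measurable N (count_space UNIV)"
proof -
  have "return_time -` {t} \<inter> space N \<in> sets N" for t
  proof (cases t)
    case (enat n)
    have "return_time -` {t} \<inter> space N
        = {\<omega> \<in> space N. (\<forall>i\<in>{..<n}. enat i < return_time \<omega>) \<and> \<not> enat n < return_time \<omega>}"
    proof -
      have "return_time \<omega> = enat n \<longleftrightarrow> (\<forall>i<n. enat i < return_time \<omega>) \<and> \<not> enat n < return_time \<omega>" for \<omega>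
        by (cases "return_time \<omega>") (auto simp: not_less intro: antisym leI)
      then show ?thesis using enat by auto
    qed
    then show ?thesis by simp
  next
    case infinity
    have "return_time -` {t} \<inter> space N = {\<omega> \<in> space N. \<forall>i. enat i < return_time \<omega>}"
    proof -
      have "return_time \<omega> = \<infinity> \<longleftrightarrow> (\<forall>i. enat i < return_time \<omega>)" for \<omega>
        by (cases "return_time \<omega>") (auto intro: exI[of _ "the_enat (return_time \<omega>)"])
      then show ?thesis using infinity by auto
    qed
    then show ?thesis by simp
  qed
  then show ?thesis by (simp add: measurable_count_space_eq2_countable)
qed

text \<open>
  Times are counted from 0 here, so \<open>visit_prob m\<close> refers to the state with index \<open>Suc m\<close>. With this
  shift the decomposition by the last visit is a convolution over \<open>{..n}\<close>.
\<close>

definition visit_prob :: "nat \<Rightarrow> real" where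
  "visit_prob m = prob {\<omega> \<in> space N. Z (Suc m) \<omega> = 0}"

definition cycle_prob :: "'e set \<Rightarrow> nat \<Rightarrow> real" where
  "cycle_prob B i = prob {\<omega> \<in> space N. enat i < return_time \<omega> \<and> Z (Suc i) \<omega> \<in> B}"

lemma cycle_prob_nonneg: "0 \<le> cycle_prob B i"
  by (simp add: cycle_prob_def)

text \<open>
  The event is split according to the last visit to 0 up to the time considered, which exists
  because the process starts in 0. Regeneration at that visit factors the probability of each piece
  into the probability of the visit and a probability about the first cycle.
\<close>

lemma prob_by_last_visit:
  assumes B [measurable]: "B \<in> sets borel"
  shows "prob {\<omega> \<in> space N. Z (Suc n) \<omega> \<in> B} = (\<Sum>m\<le>n. visit_prob m * cycle_prob B (n - m))"
proof -
  define D where "D m = {\<omega> \<in> space N. Z (Suc m) \<omega> = 0 \<and> (\<forall>i\<in>{Suc m..n}. Z (Suc i) \<omega> \<noteq> 0) \<and> Z (Suc n) \<omega> \<in> B}" for m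
  have meas: "D m \<in> sets N" for m unfolding D_def by measurable
  have union: "{\<omega> \<in> space N. Z (Suc n) \<omega> \<in> B} = (\<Union>m\<in>{..n}. D m)"
  proof (intro equalityI subsetI)
    fix \<omega> assume "\<omega> \<in> {\<omega> \<in> space N. Z (Suc n) \<omega> \<in> B}"
    then have \<omega>: "\<omega> \<in> space N" "Z (Suc n) \<omega> \<in> B" by auto
    define m where "m = Max {i\<in>{..n}. Z (Suc i) \<omega> = 0}"
    have ne: "{i\<in>{..n}. Z (Suc i) \<omega> = 0} \<noteq> {}" using Z_start[OF \<omega>(1)] by auto
    have "m \<in> {i\<in>{..n}. Z (Suc i) \<omega> = 0}" unfolding m_def using ne by (intro Max_in) auto
    moreover have "Z (Suc i) \<omega> \<noteq> 0" if "i \<in> {Suc m..n}" for i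
    proof
      assume "Z (Suc i) \<omega> = 0"
      then have "i \<le> m" unfolding m_def using that by (intro Max_ge) auto
      then show False using that by simp
    qed
    ultimately show "\<omega> \<in> (\<Union>m\<in>{..n}. D m)" using \<omega> by (auto simp: D_def)
  qed (auto simp: D_def)
  have disj: "disjoint_family_on D {..n}"
    unfolding disjoint_family_on_def
  proof (intro ballI impI)
    fix a b assume ab: "a \<in> {..n}" "b \<in> {..n}" "a \<noteq> b"
    show "D a \<inter> D b = {}"
    proof (cases "a < b")
      case True then show ?thesis using ab by (auto simp: D_def)
    next
      case False then have "b < a" using ab by simp
      then show ?thesis using ab by (auto simp: D_def)
    qed
  qed
  have step: "prob (D m) = visit_prob m * cycle_prob B (n - m)" if m: "m \<le> n" for m
  proof -
    define B' where "B' = {z \<in> space (Pi\<^sub>M UNIV (\<lambda>_::nat. borel :: 'e measure)).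
      (\<forall>i\<in>{1..n-m}. z i \<noteq> 0) \<and> z (n - m) \<in> B}"
    define A' where "A' = space (Pi\<^sub>M {1..Suc m} (\<lambda>_::nat. borel :: 'e measure))"
    have B': "B' \<in> sets (Pi\<^sub>M UNIV (\<lambda>_. borel))" unfolding B'_def by measurable
    have A': "A' \<in> sets (Pi\<^sub>M {1..Suc m} (\<lambda>_. borel))" unfolding A'_def by (rule sets.top)
    have inA: "(\<lambda>j\<in>{1..Suc m}. Z j \<omega>) \<in> A'" for \<omega>
      unfolding A'_def by (auto simp: space_PiM)
    have later: "(\<lambda>j. Z (Suc m + j) \<omega>) \<in> B' \<longleftrightarrow>
        (\<forall>i\<in>{Suc m..n}. Z (Suc i) \<omega> \<noteq> 0) \<and> Z (Suc n) \<omega> \<in> B" for \<omega>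
    proof -
      have "(\<forall>i\<in>{1..n-m}. Z (Suc m + i) \<omega> \<noteq> 0) \<longleftrightarrow> (\<forall>i\<in>{Suc m..n}. Z (Suc i) \<omega> \<noteq> 0)"
      proof
        assume *: "\<forall>i\<in>{1..n-m}. Z (Suc m + i) \<omega> \<noteq> 0"
        show "\<forall>i\<in>{Suc m..n}. Z (Suc i) \<omega> \<noteq> 0"
        proof
          fix i assume "i \<in> {Suc m..n}"
          then have "i - m \<in> {1..n-m}" "Suc m + (i - m) = Suc i" by auto
          then show "Z (Suc i) \<omega> \<noteq> 0" using bspec[OF *, of "i - m"] by simp
        qed
      qed auto
      then show ?thesis using m by (simp add: B'_def space_PiM)
    qed
    have fresh: "(\<lambda>j. Z (1 + j) \<omega>) \<in> B' \<longleftrightarrow> enat (n - m) < return_time \<omega> \<and> Z (Suc (n - m)) \<omega> \<in> B" for \<omega>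
      by (simp add: B'_def space_PiM less_return_time_iff)
    have "prob {\<omega>\<in>space N. (\<lambda>j\<in>{1..Suc m}. Z j \<omega>) \<in> A' \<and> Z (Suc m) \<omega> = 0 \<and> (\<lambda>j. Z (Suc m + j) \<omega>) \<in> B'} =
        prob {\<omega>\<in>space N. (\<lambda>j\<in>{1..Suc m}. Z j \<omega>) \<in> A' \<and> Z (Suc m) \<omega> = 0} *
        prob {\<omega>\<in>space N. (\<lambda>j. Z (1 + j) \<omega>) \<in> B'}"
      by (rule regenerative[unfolded regenerative_at_zero_def, rule_format, OF _ A' B']) simp
    then show ?thesis
      unfolding later fresh D_def visit_prob_def cycle_prob_def
      using inA[unfolded One_nat_def] by simp
  qed
  have "prob {\<omega> \<in> space N. Z (Suc n) \<omega> \<in> B} = (\<Sum>m\<in>{..n}. prob (D m))"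
    unfolding union using meas by (intro finite_measure_finite_Union disj) auto
  then show ?thesis using step by simp
qed


text \<open>
  The expected number of steps of the first cycle spent in a set, as a measure. Writing it as the
  law of the current state under probability times counting measure makes integrals against it
  accessible to Fubini.
\<close>

definition occupation :: "'e measure" where
  "occupation = distr
     (density (N \<Otimes>\<^sub>M count_space UNIV) (\<lambda>(\<omega>, i). ennreal (of_bool (enat i < return_time \<omega>))))
     (restrict_space borel S) (\<lambda>(\<omega>, i). Z (Suc i) \<omega>)"

lemma countable_time_measurable:
  assumes "\<And>i::nat. f i \<in> measurable N K"
  shows "(\<lambda>(\<omega>, i). f i \<omega>) \<in> measurable (N \<Otimes>\<^sub>M count_space UNIV) K"
proof -
  have "(\<lambda>x. f (snd x) (fst x)) \<in> measurable (N \<Otimes>\<^sub>M count_space (UNIV :: nat set)) K"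
  proof (rule measurable_compose_countable'[where f="\<lambda>i x. f i (fst x)" and g=snd and I=UNIV])
    show "(\<lambda>x. f i (fst x)) \<in> measurable (N \<Otimes>\<^sub>M count_space UNIV) K" for i
      by (rule measurable_compose[OF measurable_fst assms])
  qed simp_all
  then show ?thesis by (simp add: case_prod_unfold)
qed

lemma alive_measurable [measurable]:
  "(\<lambda>(\<omega>, i::nat). of_bool (enat i < return_time \<omega>) :: real) \<in> borel_measurable (N \<Otimes>\<^sub>M count_space UNIV)"
  by (rule countable_time_measurable) measurable

lemma alive_ennreal_measurable [measurable]:
  "(\<lambda>(\<omega>, i::nat). ennreal (of_bool (enat i < return_time \<omega>))) \<in> borel_measurable (N \<Otimes>\<^sub>M count_space UNIV)"
  by (rule countable_time_measurable) measurable

lemma path_measurable [measurable]: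
  "(\<lambda>(\<omega>, i). Z (Suc i) \<omega>) \<in> measurable (N \<Otimes>\<^sub>M count_space UNIV) (restrict_space borel S)"
  by (rule countable_time_measurable) (rule Z_Suc_restrict)

lemma sets_occupation [simp]: "sets occupation = sets (restrict_space borel S)"
  by (simp add: occupation_def)

lemma space_occupation: "space occupation = S"
  by (simp add: occupation_def space_restrict_space)

lemma emeasure_occupation:
  assumes B: "B \<in> sets borel"
  shows "emeasure occupation (B \<inter> S) = (\<Sum>i. ennreal (cycle_prob B i))"
proof -
  have BS: "B \<inter> S \<in> sets (restrict_space borel S)"
    using B by (auto simp: sets_restrict_space)
  have inS: "Z (Suc i) \<omega> \<in> S" if "\<omega> \<in> space N" for i \<omega>
    using measurable_space[OF Z_Suc_restrict that] by (simp add: space_restrict_space)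
  have "emeasure occupation (B \<inter> S)
      = (\<integral>\<^sup>+ x. indicator (B \<inter> S) x \<partial>occupation)"
    using BS by simp
  also have "\<dots> = (\<integral>\<^sup>+ (\<omega>, i). ennreal (of_bool (enat i < return_time \<omega>)) * indicator (B \<inter> S) (Z (Suc i) \<omega>)
      \<partial>(N \<Otimes>\<^sub>M count_space UNIV))"
    unfolding occupation_def using BS
    by (subst nn_integral_distr) (auto simp: nn_integral_density case_prod_unfold)
  also have "\<dots> = (\<integral>\<^sup>+ i. \<integral>\<^sup>+ \<omega>. ennreal (of_bool (enat i < return_time \<omega>)) * indicator (B \<inter> S) (Z (Suc i) \<omega>)
      \<partial>N \<partial>count_space UNIV)"
  proof -
    interpret C: sigma_finite_measure "count_space (UNIV :: nat set)"
      by (rule sigma_finite_measure_count_space)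
    interpret P: pair_sigma_finite N "count_space (UNIV :: nat set)" ..
    have "(\<lambda>(\<omega>, i). ennreal (of_bool (enat i < return_time \<omega>)) * indicator (B \<inter> S) (Z (Suc i) \<omega>))
        \<in> borel_measurable (N \<Otimes>\<^sub>M count_space UNIV)"
    proof (rule countable_time_measurable)
      fix i
      have [measurable]: "(\<lambda>\<omega>. indicator (B \<inter> S) (Z (Suc i) \<omega>) :: ennreal) \<in> borel_measurable N"
        by (rule measurable_compose[OF Z_Suc_restrict borel_measurable_indicator[OF BS]])
      show "(\<lambda>\<omega>. ennreal (of_bool (enat i < return_time \<omega>)) * indicator (B \<inter> S) (Z (Suc i) \<omega>))
          \<in> borel_measurable N" by measurable
    qed
    from P.nn_integral_snd[OF this] show ?thesis by simp
  qed
  also have "\<dots> = (\<integral>\<^sup>+ i. ennreal (cycle_prob B i) \<partial>count_space UNIV)"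
  proof (rule nn_integral_cong)
    fix i
    have "(\<integral>\<^sup>+ \<omega>. ennreal (of_bool (enat i < return_time \<omega>)) * indicator (B \<inter> S) (Z (Suc i) \<omega>) \<partial>N)
        = (\<integral>\<^sup>+ \<omega>. indicator {\<omega> \<in> space N. enat i < return_time \<omega> \<and> Z (Suc i) \<omega> \<in> B} \<omega> \<partial>N)"
      by (intro nn_integral_cong) (auto simp: indicator_def inS)
    also have "\<dots> = emeasure N {\<omega> \<in> space N. enat i < return_time \<omega> \<and> Z (Suc i) \<omega> \<in> B}"
    proof (intro nn_integral_indicator sets.sets_Collect_conj)
      show "{\<omega> \<in> space N. enat i < return_time \<omega>} \<in> sets N"
        by (rule predE[OF pred_less_return_time])
      show "{\<omega> \<in> space N. Z (Suc i) \<omega> \<in> B} \<in> sets N" using B by measurable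
    qed
    finally show "(\<integral>\<^sup>+ \<omega>. ennreal (of_bool (enat i < return_time \<omega>)) * indicator (B \<inter> S) (Z (Suc i) \<omega>) \<partial>N)
        = ennreal (cycle_prob B i)"
      by (simp add: cycle_prob_def emeasure_eq_measure)
  qed
  finally show ?thesis by (simp add: nn_integral_count_space_nat)
qed

end

locale positive_regenerative_sequence = regenerative_sequence +
  assumes finite_mean: "(\<integral>\<^sup>+ \<omega>. ennreal_of_enat (return_time \<omega>) \<partial>N) < \<infinity>"
begin

lemma occupation_total: "emeasure occupation S = (\<integral>\<^sup>+ \<omega>. ennreal_of_enat (return_time \<omega>) \<partial>N)"
proof -
  have "emeasure occupation S = (\<Sum>i. ennreal (cycle_prob UNIV i))"
    using emeasure_occupation[of UNIV] by simp
  also have "\<dots> = (\<Sum>i. emeasure N {\<omega> \<in> space N. enat i < return_time \<omega>})"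
    by (simp add: cycle_prob_def emeasure_eq_measure)
  finally show ?thesis
    unfolding nn_integral_enat_function[OF return_time_measurable] by (simp add: of_nat_eq_enat)
qed

sublocale occ: finite_measure occupation
  by (rule finite_measureI) (use finite_mean in \<open>simp add: occupation_total space_occupation\<close>)

definition mean_cycle :: real where "mean_cycle = measure occupation S"

lemma cycle_prob_sums:
  assumes B: "B \<in> sets borel"
  shows "cycle_prob B sums measure occupation (B \<inter> S)"
proof -
  have *: "(\<Sum>i. ennreal (cycle_prob B i)) = ennreal (measure occupation (B \<inter> S))"
    using emeasure_occupation[OF B] by (simp add: occ.emeasure_eq_measure)
  have summ: "summable (cycle_prob B)"
    by (rule summable_suminf_not_top) (auto simp: * cycle_prob_nonneg)
  have "ennreal (suminf (cycle_prob B)) = ennreal (measure occupation (B \<inter> S))"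
    using * suminf_ennreal2[OF cycle_prob_nonneg summ] by simp
  then have "suminf (cycle_prob B) = measure occupation (B \<inter> S)"
    using suminf_nonneg[OF summ cycle_prob_nonneg] by simp
  with summ show ?thesis by (simp add: sums_iff)
qed

lemma mean_cycle_ge_1: "1 \<le> mean_cycle"
proof -
  have "cycle_prob UNIV 0 = 1"
    using cycle_pos by (simp add: cycle_prob_def prob_space flip: zero_enat_def)
  moreover have "sum (cycle_prob UNIV) {..<1} \<le> suminf (cycle_prob UNIV)"
    using cycle_prob_sums[of UNIV] by (intro sum_le_suminf) (auto simp: sums_iff cycle_prob_nonneg)
  ultimately show ?thesis using cycle_prob_sums[of UNIV] by (simp add: mean_cycle_def sums_iff)
qed

lemma long_run_frequency:
  assumes B: "B \<in> sets borel"
  shows "(\<lambda>n. (\<Sum>i<n. prob {\<omega> \<in> space N. Z (Suc i) \<omega> \<in> B}) / real n)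
           \<longlonglongrightarrow> measure occupation (B \<inter> S) / mean_cycle"
  unfolding prob_by_last_visit[OF B]
proof (rule renewal_average)
  show "cycle_prob UNIV sums mean_cycle"
    using cycle_prob_sums[of UNIV] by (simp add: mean_cycle_def)
  show "(\<Sum>m\<le>n. visit_prob m * cycle_prob UNIV (n - m)) = 1" for n
    using prob_by_last_visit[of UNIV n] by (simp add: prob_space)
  show "0 < mean_cycle" using mean_cycle_ge_1 by simp
  show "cycle_prob B sums measure occupation (B \<inter> S)" by (rule cycle_prob_sums[OF B])
qed (simp_all add: visit_prob_def cycle_prob_nonneg)

text \<open>
  The long-run frequency of visits to a compact set \<open>K\<close> is \<open>occupation K / mean_cycle\<close> by renewal
  theory. It is also at most the limit of the averages of \<open>f (Z n)\<close>, for any bounded continuous \<open>f\<close> above the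
  indicator of \<open>K\<close>, which is \<open>\<integral>f d\<pi>\<close> by weak convergence. Letting \<open>f\<close> decrease to the
  indicator gives \<open>occupation K \<le> mean_cycle * \<pi> K\<close>, and both sides have the same total mass.
\<close>

theorem occupation_eq_stationary:
  assumes \<pi>: "prob_space \<pi>" "sets \<pi> = sets (restrict_space borel S)"
    and lim: "\<And>f :: 'b \<Rightarrow> real. continuous_on S f \<Longrightarrow> bounded (f ` S) \<Longrightarrow>
      (\<lambda>n. LINT \<omega>|N. f (Z n \<omega>)) \<longlonglongrightarrow> (LINT x|\<pi>. f x)"
  shows "occupation = density \<pi> (\<lambda>_. ennreal mean_cycle)"
proof -
  interpret \<pi>: prob_space \<pi> by fact
  let ?\<nu> = "density \<pi> (\<lambda>_. ennreal mean_cycle)"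
  have pos: "mean_cycle > 0" using mean_cycle_ge_1 by simp
  have space_\<pi>: "space \<pi> = S"
    using sets_eq_imp_space_eq[OF \<pi>(2)] by (simp add: space_restrict_space)
  have restr: "B \<inter> S \<in> sets \<pi>" if "B \<in> sets borel" for B
    using that unfolding \<pi>(2) by (auto simp: sets_restrict_space)
  have id1: "(\<lambda>x. x) \<in> borel_measurable occupation"
    unfolding measurable_cong_sets[OF sets_occupation refl] by (intro measurable_restrict_space1) simp
  have id2: "(\<lambda>x. x) \<in> borel_measurable \<pi>"
    unfolding measurable_cong_sets[OF \<pi>(2) refl] by (intro measurable_restrict_space1) simp
  have id3: "(\<lambda>x. x) \<in> borel_measurable ?\<nu>" using id2 by simp
  have em\<nu>: "emeasure ?\<nu> A = ennreal (mean_cycle * measure \<pi> A)" if "A \<in> sets \<pi>" for A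
    using that pos by (simp add: emeasure_density_const \<pi>.emeasure_eq_measure ennreal_mult)
  have compact_le: "measure occupation (K \<inter> S) \<le> mean_cycle * measure \<pi> (K \<inter> S)" if K: "compact K" for K
  proof (cases "K = {}")
    case False
    have Kb: "K \<in> sets borel" using K by (simp add: borel_compact)
    \<comment> \<open>continuous functions decreasing to the indicator of \<open>K\<close>\<close>
    define f where "f k x = max 0 (1 - real k * infdist x K)" for k :: nat and x
    have f01: "0 \<le> f k x" "f k x \<le> 1" for k x
      by (auto simp: f_def infdist_nonneg)
    have fcont: "continuous_on A (f k)" for A k
      unfolding f_def by (intro continuous_intros)
    have fborel [measurable]: "f k \<in> borel_measurable borel" for k
      by (rule borel_measurable_continuous_onI) (rule fcont)
    have f1: "f k x = 1" if "x \<in> K" for k x using that by (simp add: f_def)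
    have f\<pi>: "f k \<in> borel_measurable \<pi>" for k using measurable_compose[OF id2 fborel] by simp
    \<comment> \<open>compares the renewal limit with the weak limit\<close>
    have below: "measure occupation (K \<inter> S) / mean_cycle \<le> (LINT x|\<pi>. f k x)" for k
    proof (rule LIMSEQ_le[OF long_run_frequency[OF Kb]])
      have "(\<lambda>n. LINT \<omega>|N. f k (Z n \<omega>)) \<longlonglongrightarrow> (LINT x|\<pi>. f k x)"
        by (rule lim[OF fcont]) (auto simp: bounded_iff f01 intro!: exI[of _ 1])
      then show "(\<lambda>n. (\<Sum>i<n. LINT \<omega>|N. f k (Z (Suc i) \<omega>)) / real n) \<longlonglongrightarrow> (LINT x|\<pi>. f k x)"
        by (intro cesaro_mean) (rule LIMSEQ_Suc)
      have "prob {\<omega> \<in> space N. Z (Suc i) \<omega> \<in> K} \<le> (LINT \<omega>|N. f k (Z (Suc i) \<omega>))" for i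
      proof -
        have "prob {\<omega> \<in> space N. Z (Suc i) \<omega> \<in> K}
            = (LINT \<omega>|N. indicator {\<omega> \<in> space N. Z (Suc i) \<omega> \<in> K} \<omega>)"
          by (simp add: Int_def conj_commute)
        also have "\<dots> \<le> (LINT \<omega>|N. f k (Z (Suc i) \<omega>))"
          using Kb by (intro integral_mono integrable_const_bound[where B=1])
            (auto simp: indicator_def f01 f1)
        finally show ?thesis .
      qed
      then show "\<exists>m. \<forall>n\<ge>m. (\<Sum>i<n. prob {\<omega> \<in> space N. Z (Suc i) \<omega> \<in> K}) / real n
          \<le> (\<Sum>i<n. LINT \<omega>|N. f k (Z (Suc i) \<omega>)) / real n"
        by (intro exI[of _ 0] allI impI divide_right_mono sum_mono) auto
    qed
    have "(\<lambda>k. LINT x|\<pi>. f k x) \<longlonglongrightarrow> (LINT x|\<pi>. indicator (K \<inter> S) x)"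
    proof (rule integral_dominated_convergence[where w="\<lambda>_. 1"])
      show "AE x in \<pi>. (\<lambda>k. f k x) \<longlonglongrightarrow> indicator (K \<inter> S) x"
      proof (rule AE_I2)
        fix x assume x: "x \<in> space \<pi>"
        show "(\<lambda>k. f k x) \<longlonglongrightarrow> indicator (K \<inter> S) x"
        proof (cases "x \<in> K")
          case True
          then show ?thesis using x f1 space_\<pi> by simp
        next
          case False
          then have d: "infdist x K > 0"
            using infdist_pos_not_in_closed[OF compact_imp_closed[OF K] \<open>K \<noteq> {}\<close> False] by simp
          obtain n :: nat where n: "real n > 1 / infdist x K" using reals_Archimedean2 by blast
          have "f k x = 0" if "k \<ge> n" for k
          proof -
            have "1 < real n * infdist x K" using n d by (simp add: field_simps)
            also have "\<dots> \<le> real k * infdist x K" using that d by (intro mult_right_mono) auto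
            finally show ?thesis by (simp add: f_def)
          qed
          then have "eventually (\<lambda>k. f k x = 0) sequentially" by (rule eventually_sequentiallyI)
          then show ?thesis using False by (simp add: tendsto_eventually)
        qed
      qed
    qed (use f01 f\<pi> restr[OF Kb] in auto)
    then have "(\<lambda>k. LINT x|\<pi>. f k x) \<longlonglongrightarrow> measure \<pi> (K \<inter> S)"
      using restr[OF Kb] space_\<pi> by (simp add: Int_absorb2)
    then have "measure occupation (K \<inter> S) / mean_cycle \<le> measure \<pi> (K \<inter> S)"
      by (rule LIMSEQ_le_const) (use below in auto)
    then show ?thesis using pos by (simp add: field_simps)
  qed simp
  \<comment> \<open>both measures are moved to the Borel sets of the whole space, where inner regularity holds\<close>
  have em1: "emeasure (distr occupation borel (\<lambda>x. x)) B = emeasure occupation (B \<inter> S)" if "B \<in> sets borel" for B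
    using that by (simp add: emeasure_distr[OF id1] space_occupation)
  have em2: "emeasure (distr ?\<nu> borel (\<lambda>x. x)) B = emeasure ?\<nu> (B \<inter> S)" if "B \<in> sets borel" for B
    using that by (simp add: emeasure_distr[OF id3] space_\<pi>)
  have "distr occupation borel (\<lambda>x. x) = distr ?\<nu> borel (\<lambda>x. x)"
  proof (rule measure_eq_of_compact_le)
    show "finite_measure (distr occupation borel (\<lambda>x. x))"
      by (rule occ.finite_measure_distr[OF id1])
    have "emeasure ?\<nu> (space \<pi>) < \<infinity>" by (simp add: em\<nu>)
    then have "finite_measure ?\<nu>" by (intro finite_measureI) auto
    then show "finite_measure (distr ?\<nu> borel (\<lambda>x. x))"
      using id3 by (rule finite_measure.finite_measure_distr)
    show "emeasure (distr occupation borel (\<lambda>x. x)) K \<le> emeasure (distr ?\<nu> borel (\<lambda>x. x)) K" if K: "compact K" for K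
      using compact_le[OF K] borel_compact[OF K]
      by (simp add: em1 em2 em\<nu> restr occ.emeasure_eq_measure ennreal_leI)
    show "emeasure (distr occupation borel (\<lambda>x. x)) UNIV = emeasure (distr ?\<nu> borel (\<lambda>x. x)) UNIV"
    proof -
      have "emeasure ?\<nu> (UNIV \<inter> S) = ennreal mean_cycle"
        using em\<nu>[OF restr[of UNIV]] \<pi>.prob_space space_\<pi> by simp
      moreover have "emeasure occupation (UNIV \<inter> S) = ennreal mean_cycle"
        by (simp add: mean_cycle_def occ.emeasure_eq_measure)
      ultimately show ?thesis using em1[of UNIV] em2[of UNIV] by simp
    qed
  qed auto
  then have *: "emeasure occupation (B \<inter> S) = emeasure ?\<nu> (B \<inter> S)" if "B \<in> sets borel" for B
    using em1[OF that] em2[OF that] by simp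
  show ?thesis
  proof (rule measure_eqI)
    fix A assume "A \<in> sets occupation"
    then obtain B where "B \<in> sets borel" "A = B \<inter> S" by (auto simp: sets_restrict_space)
    then show "emeasure occupation A = emeasure ?\<nu> A" using * by simp
  qed (use \<pi>(2) in simp)
qed

definition cycle_sum :: "('b \<Rightarrow> 'c::real_normed_vector) \<Rightarrow> 'a \<Rightarrow> 'c" where
  "cycle_sum g \<omega> = (\<Sum>j\<in>{j. 1 \<le> j \<and> enat j \<le> return_time \<omega>}. g (Z j \<omega>))"

lemma cycle_sum_measurable [measurable]:
  fixes g :: "'b \<Rightarrow> 'c::{banach, second_countable_topology}"
  assumes g: "g \<in> borel_measurable (restrict_space borel S)"
  shows "cycle_sum g \<in> borel_measurable N"
proof -
  have "(\<lambda>\<omega>. \<Sum>j\<in>{j. 1 \<le> j \<and> enat j \<le> t}. g (Z j \<omega>)) \<in> borel_measurable N" for t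
    by (intro borel_measurable_sum measurable_compose[OF Z_measurable g]) auto
  from measurable_compose_countable'[OF this return_time_measurable] show ?thesis
    unfolding cycle_sum_def by simp
qed

text \<open>
  Fubini, applied to the sum over the steps of the cycle. On the null event of an infinite cycle the
  two sides of the pointwise identity may differ, since there the finite sum is 0 by convention.
\<close>

lemma expectation_cycle_sum:
  fixes g :: "'b \<Rightarrow> 'c::{banach, second_countable_topology}"
  assumes g: "integrable occupation g"
  shows "integrable N (cycle_sum g)" "(LINT \<omega>|N. cycle_sum g \<omega>) = (LINT x|occupation. g x)"
proof -
  interpret C: sigma_finite_measure "count_space (UNIV :: nat set)"
    by (rule sigma_finite_measure_count_space)
  interpret P: pair_sigma_finite N "count_space (UNIV :: nat set)" ..
  let ?f = "\<lambda>(\<omega>, i). of_bool (enat i < return_time \<omega>) *\<^sub>R g (Z (Suc i) \<omega>)"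
  have gm: "g \<in> borel_measurable (restrict_space borel S)"
    using borel_measurable_integrable[OF g] unfolding measurable_cong_sets[OF sets_occupation refl] .
  let ?D = "density (N \<Otimes>\<^sub>M count_space UNIV) (\<lambda>(\<omega>, i). ennreal (of_bool (enat i < return_time \<omega>)))"
  have m1: "(\<lambda>(\<omega>, i). Z (Suc i) \<omega>) \<in> measurable ?D (restrict_space borel S)" by simp
  have dens: "(\<lambda>(\<omega>, i). ennreal (of_bool (enat i < return_time \<omega>))) =
    (\<lambda>x. ennreal ((\<lambda>(\<omega>, i). of_bool (enat i < return_time \<omega>)) x))" by (auto simp: fun_eq_iff)
  have gp: "(\<lambda>x. g ((\<lambda>(\<omega>, i). Z (Suc i) \<omega>) x)) \<in> borel_measurable (N \<Otimes>\<^sub>M count_space UNIV)"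
    by (rule measurable_compose[OF path_measurable gm])
  have "integrable ?D (\<lambda>x. g ((\<lambda>(\<omega>, i). Z (Suc i) \<omega>) x))"
    using g unfolding occupation_def integrable_distr_eq[OF m1 gm] .
  then have int: "integrable (N \<Otimes>\<^sub>M count_space UNIV) ?f"
    unfolding dens by (subst (asm) integrable_density[OF gp alive_measurable]) (auto simp: case_prod_unfold)
  have "(LINT x|occupation. g x) = (LINT x|?D. g ((\<lambda>(\<omega>, i). Z (Suc i) \<omega>) x))"
    unfolding occupation_def by (rule integral_distr[OF m1 gm])
  also have "\<dots> = (LINT x|(N \<Otimes>\<^sub>M count_space UNIV). ?f x)"
    unfolding dens by (subst integral_density[OF gp alive_measurable]) (auto simp: case_prod_unfold)
  also have "\<dots> = (LINT \<omega>|N. LINT i|(count_space UNIV). ?f (\<omega>, i))"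
    by (rule P.integral_fst'[OF int, symmetric])
  finally have eq: "(LINT x|occupation. g x) = (LINT \<omega>|N. LINT i|(count_space UNIV). ?f (\<omega>, i))" .
  have "AE \<omega> in N. ennreal_of_enat (return_time \<omega>) \<noteq> \<infinity>"
    using finite_mean measurable_compose[OF return_time_measurable, of ennreal_of_enat borel]
    by (intro nn_integral_PInf_AE) auto
  then have ae: "AE \<omega> in N. (LINT i|(count_space UNIV). ?f (\<omega>, i)) = cycle_sum g \<omega>"
  proof eventually_elim
    case (elim \<omega>)
    then obtain t where t: "return_time \<omega> = enat t" by (cases "return_time \<omega>") auto
    have "(LINT i|(count_space UNIV). ?f (\<omega>, i)) = (\<Sum>i\<in>{..<t}. ?f (\<omega>, i))"
    proof -
      have "(LINT i|(count_space UNIV). ?f (\<omega>, i)) = (\<Sum>i | i \<in> UNIV \<and> ?f (\<omega>, i) \<noteq> 0. ?f (\<omega>, i))"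
        by (rule lebesgue_integral_count_space_finite_support)
           (rule finite_subset[of _ "{..<t}"], auto simp: t)
      also have "\<dots> = (\<Sum>i\<in>{..<t}. ?f (\<omega>, i))"
        by (rule sum.mono_neutral_left) (auto simp: t)
      finally show ?thesis .
    qed
    also have "\<dots> = (\<Sum>i\<in>{..<t}. g (Z (Suc i) \<omega>))" by (simp add: t)
    also have "\<dots> = (\<Sum>j\<in>Suc ` {..<t}. g (Z j \<omega>))" by (simp add: sum.reindex)
    also have "Suc ` {..<t} = {j. 1 \<le> j \<and> enat j \<le> return_time \<omega>}"
      unfolding t image_Suc_lessThan by auto
    finally show ?case by (simp add: cycle_sum_def)
  qed
  have m2: "(\<lambda>\<omega>. LINT i|(count_space UNIV). ?f (\<omega>, i)) \<in> borel_measurable N"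
    using P.integrable_fst'[OF int] by auto
  show "integrable N (cycle_sum g)"
    using P.integrable_fst'[OF int] integrable_cong_AE[OF m2 cycle_sum_measurable[OF gm] ae] by simp
  show "(LINT \<omega>|N. cycle_sum g \<omega>) = (LINT x|occupation. g x)"
    unfolding eq by (rule integral_cong_AE[OF cycle_sum_measurable[OF gm] m2, symmetric, THEN sym]) (use ae in auto)
qed

end

section \<open>The mean of the cycle estimator\<close>

context queueing_game
begin

lemma arrival_gt_0:
  assumes "p \<in> strategies" "\<omega> \<in> space (strat_prob \<G> p)" "1 \<le> n"
  shows "0 < arrival \<G> n \<omega>"
  using assms(3)
proof (induction n rule: nat_induct_at_least)
  case base
  show ?case using arrival_pos assms by simp
next
  case (Suc n)
  then show ?case using arrival_less[OF assms(1,2), of n] by simp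
qed

lemma pre_arrival_limit:
  assumes "p \<in> strategies" "\<omega> \<in> space (strat_prob \<G> p)" "1 \<le> n"
  shows "((\<lambda>t. state_proc \<G> p t \<omega>) \<longlongrightarrow> pre_arrival \<G> p n \<omega>) (at_left (arrival \<G> n \<omega>))"
    and "pre_arrival \<G> p n \<omega> \<in> state_set \<G>"
proof -
  obtain l where l: "l \<in> state_set \<G>"
      "((\<lambda>s. state_proc \<G> p s \<omega>) \<longlongrightarrow> l) (at_left (arrival \<G> n \<omega>))"
    using state_left_limit[OF assms(1,2) arrival_gt_0[OF assms]] by blast
  have "pre_arrival \<G> p n \<omega> = l"
    unfolding pre_arrival_def by (rule tendsto_Lim[OF _ l(2)]) simp
  then show "((\<lambda>t. state_proc \<G> p t \<omega>) \<longlongrightarrow> pre_arrival \<G> p n \<omega>) (at_left (arrival \<G> n \<omega>))"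
    "pre_arrival \<G> p n \<omega> \<in> state_set \<G>" using l by auto
qed

text \<open>
  The left limit at the arrival time is the limit of the states at the last point strictly before it
  of finer and finer time grids. Each of these approximations is measurable because it combines
  countably many of the given random variables.
\<close>

lemma pre_arrival_measurable:
  assumes p: "p \<in> strategies" and n: "1 \<le> n"
  shows "pre_arrival \<G> p n \<in> measurable (strat_prob \<G> p) (restrict_space borel (state_set \<G>))"
proof (rule measurable_restrict_space2)
  show "pre_arrival \<G> p n \<in> space (strat_prob \<G> p) \<rightarrow> state_set \<G>"
    using pre_arrival_limit(2)[OF p _ n] by auto
  \<comment> \<open>index of the last multiple of \<open>1 / Suc k\<close> strictly before the arrival; the ceiling minus one, rather than the floor, keeps it strictly before\<close>
  define grid where "grid k \<omega> = nat (\<lceil>real (Suc k) * arrival \<G> n \<omega>\<rceil> - 1)" for k \<omega>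
  show "pre_arrival \<G> p n \<in> borel_measurable (strat_prob \<G> p)"
  proof (rule borel_measurable_LIMSEQ_metric)
    fix k
    note [measurable] = arrival_measurable[OF p n]
    have grid: "grid k \<in> measurable (strat_prob \<G> p) (count_space UNIV)"
      unfolding grid_def by measurable
    have "state_proc \<G> p (real i / real (Suc k)) \<in> borel_measurable (strat_prob \<G> p)" for i
      using state_measurable[OF p, of "real i / real (Suc k)"]
      by (simp add: state_algebra_def measurable_restrict_space2_iff)
    from measurable_compose_countable'[OF this grid]
    show "(\<lambda>\<omega>. state_proc \<G> p (real (grid k \<omega>) / real (Suc k)) \<omega>) \<in> borel_measurable (strat_prob \<G> p)"
      by simp
  next
    fix \<omega> assume \<omega>: "\<omega> \<in> space (strat_prob \<G> p)"
    let ?T = "arrival \<G> n \<omega>"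
    have T: "0 < ?T" by (rule arrival_gt_0[OF p \<omega> n])
    have g: "real (Suc k) * ?T - 1 \<le> real (grid k \<omega>)" "real (grid k \<omega>) < real (Suc k) * ?T" for k
    proof -
      have "0 < real (Suc k) * ?T" using T by simp
      then have "0 \<le> \<lceil>real (Suc k) * ?T\<rceil> - 1" by linarith
      then have "real (grid k \<omega>) = real_of_int \<lceil>real (Suc k) * ?T\<rceil> - 1"
        unfolding grid_def by simp
      then show "real (Suc k) * ?T - 1 \<le> real (grid k \<omega>)" "real (grid k \<omega>) < real (Suc k) * ?T"
        by linarith+
    qed
    have less: "real (grid k \<omega>) / real (Suc k) < ?T" for k
      using g(2)[of k] by (simp add: pos_divide_less_eq mult.commute)
    have ge: "?T - 1 / real (Suc k) \<le> real (grid k \<omega>) / real (Suc k)" for k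
    proof -
      have "(?T - 1 / real (Suc k)) * real (Suc k) = real (Suc k) * ?T - 1"
        unfolding left_diff_distrib by (simp del: of_nat_Suc)
      then show ?thesis using g(1)[of k] by (simp add: pos_le_divide_eq del: of_nat_Suc)
    qed
    have "(\<lambda>k. ?T - 1 / real (Suc k)) \<longlonglongrightarrow> ?T - 0"
      using LIMSEQ_inverse_real_of_nat by (intro tendsto_diff tendsto_const) (simp only: inverse_eq_divide)
    then have "(\<lambda>k. ?T - 1 / real (Suc k)) \<longlonglongrightarrow> ?T" by (simp only: diff_zero)
    then have lim: "(\<lambda>k. real (grid k \<omega>) / real (Suc k)) \<longlonglongrightarrow> ?T"
      by (rule tendsto_sandwich[OF always_eventually[OF allI[OF ge]]
        always_eventually[OF allI[OF less_imp_le[OF less]]] _ tendsto_const])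
    have "filterlim (\<lambda>k. real (grid k \<omega>) / real (Suc k)) (at_left ?T) sequentially"
      unfolding filterlim_at using lim less
      by (intro conjI always_eventually allI) (simp_all only: lessThan_iff not_False_eq_True less_imp_neq simp_thms)
    from filterlim_compose[OF pre_arrival_limit(1)[OF p \<omega> n] this]
    show "(\<lambda>k. state_proc \<G> p (real (grid k \<omega>) / real (Suc k)) \<omega>) \<longlonglongrightarrow> pre_arrival \<G> p n \<omega>" .
  qed
qed

lemma pre_arrival_regenerative:
  assumes "p \<in> strategies"
  shows "regenerative_sequence (strat_prob \<G> p) (state_set \<G>) (pre_arrival \<G> p)"
  using prob[OF assms] pre_arrival_measurable[OF assms] starts_empty[OF assms] regenerative[OF assms]
  by (intro regenerative_sequence.intro regenerative_sequence_axioms.intro) auto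

text \<open>
  Cycles have length at least 1, so the mean cycle length is bounded by the second moment.
\<close>

lemma pre_arrival_positive_regenerative:
  assumes p: "p \<in> strategies" and fin: "cycle_moment 2 \<G> p < \<infinity>"
  shows "positive_regenerative_sequence (strat_prob \<G> p) (state_set \<G>) (pre_arrival \<G> p)"
proof -
  interpret regenerative_sequence "strat_prob \<G> p" "state_set \<G>" "pre_arrival \<G> p"
    by (rule pre_arrival_regenerative[OF p])
  have "(\<integral>\<^sup>+ \<omega>. ennreal_of_enat (return_time \<omega>) \<partial>strat_prob \<G> p) \<le> cycle_moment 2 \<G> p"
    unfolding cycle_moment_def
  proof (rule nn_integral_mono)
    fix \<omega>
    have eq: "cycle_length \<G> p \<omega> = return_time \<omega>" by (simp add: cycle_length_def return_time_def)
    have "1 \<le> return_time \<omega>"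
      using cycle_pos by (simp add: Suc_ile_eq one_enat_def)
    then have "1 \<le> ennreal_of_enat (return_time \<omega>)"
      using ennreal_of_enat_le_iff[of 1] by simp
    then have "1 * ennreal_of_enat (return_time \<omega>) \<le> ennreal_of_enat (return_time \<omega>) * ennreal_of_enat (return_time \<omega>)"
      by (rule mult_right_mono) simp
    then show "ennreal_of_enat (return_time \<omega>) \<le> (ennreal_of_enat (cycle_length \<G> p \<omega>))\<^sup>2"
      unfolding eq by (simp add: power2_eq_square)
  qed
  then have "(\<integral>\<^sup>+ \<omega>. ennreal_of_enat (return_time \<omega>) \<partial>strat_prob \<G> p) < \<infinity>"
    using fin by (rule le_less_trans)
  then show ?thesis
    by (intro positive_regenerative_sequence.intro positive_regenerative_sequence_axioms.intro
      regenerative_sequence_axioms)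
qed

text \<open>
  The estimator does not estimate the utility itself but a multiple of it, the factor being the mean
  cycle length. As the factor is at least 1, it preserves the direction of a drift towards a point
  and can only strengthen it.
\<close>

lemma cycle_estimator_mean:
  assumes p: "p \<in> strategies" and fin: "cycle_moment 2 \<G> p < \<infinity>"
  shows "cycle_estimator \<G> p \<in> borel_measurable (strat_prob \<G> p)"
    and "integrable (strat_prob \<G> p) (cycle_estimator \<G> p)"
    and "\<exists>c\<ge>1. (LINT \<omega>|strat_prob \<G> p. cycle_estimator \<G> p \<omega>) = c *\<^sub>R utility \<G> p"
proof -
  interpret positive_regenerative_sequence "strat_prob \<G> p" "state_set \<G>" "pre_arrival \<G> p"
    by (rule pre_arrival_positive_regenerative[OF p fin])
  have est: "cycle_estimator \<G> p = cycle_sum (mean_val \<G> p)"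
    by (rule ext) (simp add: cycle_estimator_def cycle_sum_def cycle_length_def return_time_def)
  have occ: "occupation = density (stat_law \<G> p) (\<lambda>_. ennreal mean_cycle)"
    using stat_prob[OF p] stat_sets[OF p] stat_limit[OF p]
    by (intro occupation_eq_stationary) (auto simp: state_algebra_def)
  have int: "integrable (stat_law \<G> p) (mean_val \<G> p)" by (rule mean_val_integrable[OF p])
  have ge: "AE x in stat_law \<G> p. 0 \<le> mean_cycle" using mean_cycle_ge_1 by simp
  have int': "integrable occupation (mean_val \<G> p)"
    unfolding occ using int integrable_density[of "mean_val \<G> p" "stat_law \<G> p" "\<lambda>_. mean_cycle"] ge by simp
  have eq: "(LINT x|occupation. mean_val \<G> p x) = mean_cycle *\<^sub>R utility \<G> p"
    unfolding occ utility_def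
    using int integral_density[of "mean_val \<G> p" "stat_law \<G> p" "\<lambda>_. mean_cycle"] ge by simp
  show int'': "integrable (strat_prob \<G> p) (cycle_estimator \<G> p)"
    unfolding est by (rule expectation_cycle_sum(1)[OF int'])
  show "\<exists>c\<ge>1. (LINT \<omega>|strat_prob \<G> p. cycle_estimator \<G> p \<omega>) = c *\<^sub>R utility \<G> p"
    unfolding est using expectation_cycle_sum(2)[OF int'] eq mean_cycle_ge_1 by auto
  show "cycle_estimator \<G> p \<in> borel_measurable (strat_prob \<G> p)"
    using int'' by (rule borel_measurable_integrable)
qed

end

section \<open>The simplex and the potential\<close>

lemma closed_strategies: "closed (strategies :: (real ^ 'k::finite) set)"
proof -
  have "strategies = (\<Inter>i. {p. 0 \<le> p $ i}) \<inter> {p :: real ^ 'k. (\<Sum>i\<in>UNIV. p $ i) = 1}"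
    by (auto simp: strategies_def)
  also have "closed \<dots>"
    by (intro closed_Int closed_INT ballI closed_Collect_le closed_Collect_eq continuous_intros)
  finally show ?thesis .
qed

lemma norm_strategy_le_1: "p \<in> strategies \<Longrightarrow> norm p \<le> 1"
  using norm_le_l1_cart[of p] by (auto simp: strategies_def)

lemma compact_strategies: "compact (strategies :: (real ^ 'k::finite) set)"
  unfolding compact_eq_bounded_closed
  using closed_strategies norm_strategy_le_1 by (auto simp: bounded_iff)

lemma convex_strategies: "convex (strategies :: (real ^ 'k::finite) set)"
  unfolding convex_def strategies_def
  by (auto simp: sum.distrib sum_distrib_left[symmetric])

lemma norm_strategy_diff_le_2:
  "p \<in> strategies \<Longrightarrow> q \<in> strategies \<Longrightarrow> norm (p - q) \<le> 2"
  using norm_triangle_ineq4[of p q] norm_strategy_le_1[of p] norm_strategy_le_1[of q] by linarith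

lemma strategy_diff_tangent:
  "p \<in> strategies \<Longrightarrow> q \<in> strategies \<Longrightarrow> p - q \<in> tangent_space"
  by (simp add: strategies_def tangent_space_def ones_def inner_vec_def sum_subtractf)

text \<open>
  The projection onto the tangent space subtracts a multiple of the all-ones vector, which tangent
  vectors do not see. So in every pairing with a difference of two strategies the projected utility
  may be replaced by the utility itself.
\<close>

lemma inner_tangent_proj:
  fixes x y :: "real ^ 'k::finite"
  assumes y: "y \<in> tangent_space"
  shows "(tangent_proj *v x) \<bullet> y = x \<bullet> y"
proof -
  define c where "c = ones \<bullet> (ones :: real ^ 'k)"
  have c: "c > 0"
    unfolding c_def ones_def by (simp add: inner_vec_def)
  define f where "f x = x - ((ones \<bullet> x) / c) *\<^sub>R (ones :: real ^ 'k)" for x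
  have sub: "subspace (tangent_space :: (real ^ 'k) set)"
    unfolding tangent_space_def by (auto simp: subspace_def inner_add_right)
  have fT: "f x \<in> tangent_space" for x
    using c unfolding f_def tangent_space_def by (simp add: inner_diff_right c_def[symmetric])
  have le: "dist x (f x) \<le> dist x z" if z: "z \<in> tangent_space" for x z
  proof -
    have w: "f x - z \<in> tangent_space" using sub fT z by (rule subspace_diff)
    have "x - z = ((ones \<bullet> x) / c) *\<^sub>R ones + (f x - z)" by (simp add: f_def)
    moreover have "orthogonal (((ones \<bullet> x) / c) *\<^sub>R ones) (f x - z)"
      using w by (simp add: orthogonal_def tangent_space_def)
    ultimately have "(norm (x - z))\<^sup>2 = (norm (((ones \<bullet> x) / c) *\<^sub>R (ones :: real ^ 'k)))\<^sup>2 + (norm (f x - z))\<^sup>2"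
      using norm_add_Pythagorean by metis
    moreover have "x - f x = ((ones \<bullet> x) / c) *\<^sub>R ones" by (simp add: f_def)
    ultimately have "(norm (x - f x))\<^sup>2 \<le> (norm (x - z))\<^sup>2" by simp
    then show ?thesis unfolding dist_norm using power2_le_imp_le norm_ge_zero by blast
  qed
  have "f x = closest_point tangent_space x" for x
    using sub fT le by (intro closest_point_unique) (auto simp: subspace_imp_convex closed_subspace)
  then have feq: "closest_point tangent_space = f" by auto
  have "linear f"
    unfolding f_def
    by (rule linearI) (auto simp: inner_add_right algebra_simps add_divide_distrib)
  then have "tangent_proj *v x = f x"
    unfolding tangent_proj_def feq by (simp add: matrix_works linear_matrix_vector_mul_eq)
  then show ?thesis using y unfolding f_def
    by (simp add: inner_diff_left tangent_space_def)
qed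

text \<open>
  The supremum in the definition is over a compact set, hence finite, and can be traded for a
  universal quantifier.
\<close>

lemma eps_equilibrium_iff:
  assumes "p \<in> strategies"
  shows "eps_equilibrium u \<epsilon> p \<longleftrightarrow> (\<forall>q\<in>strategies. u p \<bullet> q - u p \<bullet> p \<le> \<epsilon>)"
proof -
  have "compact ((\<bullet>) (u p) ` strategies)"
    by (intro compact_continuous_image compact_strategies continuous_intros)
  then have bdd: "bdd_above ((\<bullet>) (u p) ` strategies)"
    by (intro bounded_imp_bdd_above compact_imp_bounded)
  have "eps_equilibrium u \<epsilon> p \<longleftrightarrow> (SUP q\<in>strategies. u p \<bullet> q) \<le> u p \<bullet> p + \<epsilon>"
    using assms by (auto simp: eps_equilibrium_def)
  also have "\<dots> \<longleftrightarrow> (\<forall>q\<in>strategies. u p \<bullet> q \<le> u p \<bullet> p + \<epsilon>)"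
    using assms bdd by (subst cSUP_le_iff) auto
  finally show ?thesis by (auto simp: algebra_simps)
qed

text \<open>
  Needed for the event in the final probability bound to be measurable.
\<close>

lemma closed_eps_equilibria:
  assumes u: "continuous_on strategies u"
  shows "closed {p \<in> strategies. eps_equilibrium u \<epsilon> p}"
proof -
  have eq: "{p \<in> strategies. eps_equilibrium u \<epsilon> p}
      = strategies \<inter> (\<Inter>q\<in>strategies. {p \<in> strategies. u p \<bullet> q - u p \<bullet> p \<le> \<epsilon>})"
    using eps_equilibrium_iff[of _ u \<epsilon>] by auto
  have "closed {p \<in> strategies. u p \<bullet> q - u p \<bullet> p \<le> \<epsilon>}" for q
    by (rule continuous_on_closed_Collect_le[OF _ continuous_on_const closed_strategies])
       (intro continuous_intros u)
  then show ?thesis unfolding eq by (intro closed_Int closed_strategies closed_INT ballI) auto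
qed

lemma locally_lipschitz_on_imp_continuous_on:
  assumes "locally_lipschitz_on S f"
  shows "continuous_on S f"
proof -
  have "continuous (at x within S) f" if "x \<in> S" for x
  proof -
    obtain r K where r: "r > 0" "lipschitz_on K (cball x r \<inter> S) f"
      using assms \<open>x \<in> S\<close> unfolding locally_lipschitz_on_def by blast
    have "continuous (at x within cball x r \<inter> S) f"
      using lipschitz_on_continuous_on[OF r(2)] r(1) that
      by (simp add: continuous_on_eq_continuous_within)
    moreover have "at x within S = at x within (cball x r \<inter> S)"
      by (rule at_within_nhd[of _ "ball x r"]) (use r in auto)
    ultimately show ?thesis by (simp add: continuous_within)
  qed
  then show ?thesis by (simp add: continuous_on_eq_continuous_within)
qed

text \<open>
  Near \<open>x\<close> the local Lipschitz constant applies; at distance more than \<open>r\<close> from \<open>x\<close> the function is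
  bounded by compactness, and a bounded quantity is at most a multiple of the distance there.
\<close>

lemma locally_lipschitz_on_linear_growth:
  fixes f :: "'a::metric_space \<Rightarrow> 'b::real_normed_vector"
  assumes "locally_lipschitz_on S f" "compact S" "x \<in> S"
  obtains K where "0 \<le> K" "\<And>y. y \<in> S \<Longrightarrow> norm (f y - f x) \<le> K * dist y x"
proof -
  obtain r L where r: "r > 0" and L: "lipschitz_on L (cball x r \<inter> S) f"
    using assms(1,3) unfolding locally_lipschitz_on_def by blast
  have L0: "L \<ge> 0" using L by (rule lipschitz_on_nonneg)
  have "compact (f ` S)"
    by (intro compact_continuous_image locally_lipschitz_on_imp_continuous_on assms)
  then obtain B where B: "\<And>y. y \<in> S \<Longrightarrow> norm (f y) \<le> B"
    using compact_imp_bounded by (force simp: bounded_iff)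
  have B0: "0 \<le> B" using B[OF assms(3)] norm_ge_zero order_trans by blast
  have "norm (f y - f x) \<le> (L + 2 * B / r) * dist y x" if y: "y \<in> S" for y
  proof (cases "dist y x \<le> r")
    case True
    have "norm (f y - f x) \<le> L * dist y x"
      unfolding dist_norm[symmetric]
      using True y assms(3) r by (intro lipschitz_onD[OF L]) (auto simp: dist_commute)
    moreover have "0 \<le> 2 * B / r * dist y x" using B0 r by simp
    ultimately show ?thesis by (simp add: distrib_right)
  next
    case False
    have "norm (f y - f x) \<le> 2 * B"
      using norm_triangle_ineq4[of "f y" "f x"] B[OF y] B[OF assms(3)] by linarith
    also have "\<dots> = 2 * B / r * r" using r by simp
    also have "\<dots> \<le> 2 * B / r * dist y x"
      using False B0 r by (intro mult_left_mono) auto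
    also have "\<dots> \<le> (L + 2 * B / r) * dist y x" using L0 by (intro mult_right_mono) auto
    finally show ?thesis .
  qed
  moreover have "0 \<le> L + 2 * B / r" using L0 B0 r by simp
  ultimately show thesis using that by blast
qed

text \<open>
  The point \<open>p\<close> minimises the convex potential \<open>f\<close>. Comparing \<open>f p\<close> with \<open>f\<close> at points moving from
  \<open>q\<close> to \<open>p\<close> along a segment gives \<open>u x \<bullet> (q - p) \<le> 0\<close> at those points, and continuity carries this
  to \<open>p\<close>: no action improves on \<open>p\<close>. Adding the two strong convexity inequalities between \<open>p\<close> and
  \<open>q\<close> then gives the second estimate, which says that the utility field pulls every strategy back
  towards \<open>p\<close> at a rate proportional to its distance.
\<close>

lemma potential_minimiser_exists:
  fixes u :: "real ^ 'k::finite \<Rightarrow> real ^ 'k"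
  assumes ne: "strategies \<noteq> ({} :: (real ^ 'k) set)"
    and cont: "continuous_on strategies (\<lambda>p. tangent_proj *v u p)"
    and grad: "\<forall>p\<in>strategies. has_simplex_gradient f p (- (tangent_proj *v u p))"
    and C: "C > 0"
    and conv: "\<forall>p\<in>strategies. \<forall>q\<in>strategies.
         f p \<ge> f q - (tangent_proj *v u q) \<bullet> (p - q) + C / 2 * (norm (p - q))\<^sup>2"
  obtains p where "p \<in> strategies" "\<And>q. q \<in> strategies \<Longrightarrow> u p \<bullet> (q - p) \<le> 0"
    "\<And>q. q \<in> strategies \<Longrightarrow> u q \<bullet> (q - p) \<le> - C * (norm (q - p))\<^sup>2"
proof -
  have contf: "continuous_on strategies f"
    using grad unfolding has_simplex_gradient_def continuous_on_eq_continuous_within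
    by (blast intro: has_derivative_continuous)
  obtain p where p: "p \<in> strategies" and min: "\<And>q. q \<in> strategies \<Longrightarrow> f p \<le> f q"
    using continuous_attains_inf[OF compact_strategies ne contf] by blast
  have conv': "f r \<ge> f q - u q \<bullet> (r - q) + C / 2 * (norm (r - q))\<^sup>2"
    if "q \<in> strategies" "r \<in> strategies" for q r
    using conv[rule_format, OF that(2,1)]
      inner_tangent_proj[OF strategy_diff_tangent[OF that(2,1)], of "u q"] by simp
  have first: "u p \<bullet> (q - p) \<le> 0" if q: "q \<in> strategies" for q
  proof -
    define x where "x n = p + (1 / real (Suc n)) *\<^sub>R (q - p)" for n
    have xS: "x n \<in> strategies" for n
    proof -
      have "x n = (1 - 1 / real (Suc n)) *\<^sub>R p + (1 / real (Suc n)) *\<^sub>R q"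
        unfolding x_def by (simp add: algebra_simps)
      then show ?thesis using convexD[OF convex_strategies p q] by simp
    qed
    have step: "(tangent_proj *v u (x n)) \<bullet> (q - p) \<le> 0" for n
    proof -
      have "f p \<ge> f (x n) - u (x n) \<bullet> (p - x n) + C / 2 * (norm (p - x n))\<^sup>2"
        by (rule conv'[OF xS p])
      moreover have "f p \<le> f (x n)" by (rule min[OF xS])
      moreover have "0 \<le> C / 2 * (norm (p - x n))\<^sup>2" using C by simp
      ultimately have "u (x n) \<bullet> (p - x n) \<ge> 0" by linarith
      moreover have "p - x n = - (1 / real (Suc n)) *\<^sub>R (q - p)" by (simp add: x_def)
      ultimately have "(1 / real (Suc n)) * (u (x n) \<bullet> (q - p)) \<le> 0" by simp
      then have "u (x n) \<bullet> (q - p) \<le> 0" by (simp add: divide_le_0_iff)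
      then show ?thesis using inner_tangent_proj[OF strategy_diff_tangent[OF q p]] by simp
    qed
    have "x \<longlonglongrightarrow> p + 0 *\<^sub>R (q - p)"
      unfolding x_def by (intro tendsto_intros LIMSEQ_inverse_real_of_nat[unfolded inverse_eq_divide])
    then have "(\<lambda>n. tangent_proj *v u (x n)) \<longlonglongrightarrow> tangent_proj *v u p"
      using continuous_on_tendsto_compose[OF cont _ p] xS by (auto intro!: always_eventually)
    then have "(\<lambda>n. (tangent_proj *v u (x n)) \<bullet> (q - p)) \<longlonglongrightarrow> (tangent_proj *v u p) \<bullet> (q - p)"
      by (intro tendsto_intros)
    then have "(tangent_proj *v u p) \<bullet> (q - p) \<le> 0"
      by (rule LIMSEQ_le_const2) (use step in auto)
    then show ?thesis using inner_tangent_proj[OF strategy_diff_tangent[OF q p]] by simp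
  qed
  have second: "u q \<bullet> (q - p) \<le> - C * (norm (q - p))\<^sup>2" if q: "q \<in> strategies" for q
  proof -
    have "f p \<ge> f q - u q \<bullet> (p - q) + C / 2 * (norm (p - q))\<^sup>2" by (rule conv'[OF q p])
    moreover have "f q \<ge> f p - u p \<bullet> (q - p) + C / 2 * (norm (q - p))\<^sup>2" by (rule conv'[OF p q])
    moreover have "u q \<bullet> (p - q) = - (u q \<bullet> (q - p))" by (simp add: inner_diff_right)
    moreover have "norm (p - q) = norm (q - p)" by (rule norm_minus_commute)
    ultimately show ?thesis using first[OF q] by simp
  qed
  show thesis using that p first second by blast
qed

text \<open>
  The regret is nonpositive at \<open>p\<close> itself, and moving from \<open>p\<close> to \<open>q\<close> changes both the utility
  vector and the strategy it is compared with by a multiple of \<open>norm (q - p)\<close>.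
\<close>

lemma regret_le_distance:
  fixes u :: "real ^ 'k::finite \<Rightarrow> real ^ 'k"
  assumes lip: "locally_lipschitz_on strategies u" and p: "p \<in> strategies"
    and opt: "\<And>q. q \<in> strategies \<Longrightarrow> u p \<bullet> (q - p) \<le> 0"
  obtains K where "0 < K"
    "\<And>q r. q \<in> strategies \<Longrightarrow> r \<in> strategies \<Longrightarrow> u q \<bullet> r - u q \<bullet> q \<le> K * norm (q - p)"
proof -
  obtain L where L: "0 \<le> L" "\<And>q. q \<in> strategies \<Longrightarrow> norm (u q - u p) \<le> L * dist q p"
    using locally_lipschitz_on_linear_growth[OF lip compact_strategies p] by blast
  \<comment> \<open>the factor 2 bounds the diameter of the simplex, and the summand 1 makes the constant positive\<close>
  have "u q \<bullet> r - u q \<bullet> q \<le> (L * 2 + norm (u p) + 1) * norm (q - p)"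
    if q: "q \<in> strategies" and r: "r \<in> strategies" for q r
  proof -
    have "u q \<bullet> r - u q \<bullet> q = u p \<bullet> (r - p) + (u q - u p) \<bullet> (r - q) - u p \<bullet> (q - p)"
      by (simp add: inner_diff_left inner_diff_right)
    moreover have "u p \<bullet> (r - p) \<le> 0" by (rule opt[OF r])
    moreover have "(u q - u p) \<bullet> (r - q) \<le> (L * norm (q - p)) * 2"
    proof -
      have "(u q - u p) \<bullet> (r - q) \<le> norm (u q - u p) * norm (r - q)" by (rule norm_cauchy_schwarz)
      also have "\<dots> \<le> (L * norm (q - p)) * 2"
        using L(2)[OF q] L(1) norm_strategy_diff_le_2[OF r q]
        by (intro mult_mono) (auto simp: dist_norm)
      finally show ?thesis .
    qed
    moreover have "- (u p \<bullet> (q - p)) \<le> norm (u p) * norm (q - p)"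
      using norm_cauchy_schwarz[of "u p" "- (q - p)"] by (simp add: inner_diff_right norm_minus_commute)
    ultimately show ?thesis by (simp add: algebra_simps) (smt (verit) norm_ge_zero)
  qed
  then show thesis using that[of "L * 2 + norm (u p) + 1"] L(1) norm_ge_zero[of "u p"]
    by (simp add: add_nonneg_pos)
qed

section \<open>Conditional laws\<close>

text \<open>
  The conditional law is pinned down only almost everywhere, one Borel set at a time. Passing to the
  completion turns it into a genuine kernel without choosing a version.
\<close>

lemma measurable_completion_cong_AE:
  fixes f g :: "'s \<Rightarrow> real"
  assumes g: "g \<in> borel_measurable M" and ae: "AE s in M. g s = f s"
  shows "f \<in> borel_measurable (completion M)"
proof -
  obtain N where N: "N \<in> null_sets M" "{s \<in> space M. g s \<noteq> f s} \<subseteq> N"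
    using ae by (auto elim!: AE_E)
  show ?thesis
  proof (rule measurableI)
    fix A :: "real set" assume A: "A \<in> sets borel"
    have "f -` A \<inter> space M = (g -` A \<inter> (space M - N)) \<union> (f -` A \<inter> space M \<inter> N)"
      using N(2) by auto
    moreover have "g -` A \<inter> (space M - N) = (g -` A \<inter> space M) - N" by auto
    ultimately have "f -` A \<inter> space M = ((g -` A \<inter> space M) - N) \<union> (f -` A \<inter> space M \<inter> N)"
      by simp
    then show "f -` A \<inter> space (completion M) \<in> sets (completion M)"
      using N(1) measurable_sets[OF g A]
      by (intro sets_completionI[where S="(g -` A \<inter> space M) - N" and N="f -` A \<inter> space M \<inter> N" and N'=N])
        auto
  qed simp
qed

text \<open>
  A value known from the past can be treated as a constant when integrating against the conditional
  law. The joint law of \<open>X\<close> and \<open>Z\<close> and the law obtained by first drawing \<open>s\<close> and then drawing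
  from \<open>\<kappa> s\<close> agree on rectangles, by the defining property of the conditional expectation, and hence
  agree. Nonnegative integrands suffice for squared distances.
\<close>

lemma nn_integral_cond_law:
  fixes X :: "'s \<Rightarrow> 'x::second_countable_topology" and Z :: "'s \<Rightarrow> 'e::second_countable_topology"
  assumes M: "prob_space M" and sub: "subalgebra M F"
    and X: "X \<in> borel_measurable F" and Z: "Z \<in> borel_measurable M"
    and law: "has_cond_law M F Z \<kappa>"
    and \<kappa>: "\<And>s. s \<in> space M \<Longrightarrow> prob_space (\<kappa> s)" "\<And>s. s \<in> space M \<Longrightarrow> sets (\<kappa> s) = sets borel"
    and \<phi>: "\<phi> \<in> borel_measurable (borel \<Otimes>\<^sub>M borel)"
  shows "(\<integral>\<^sup>+ s. \<phi> (X s, Z s) \<partial>M) = (\<integral>\<^sup>+ s. \<integral>\<^sup>+ e. \<phi> (X s, e) \<partial>\<kappa> s \<partial>M)"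
proof -
  interpret prob_space M by fact
  interpret sub: finite_measure_subalgebra M F
    by (intro finite_measure_subalgebra.intro finite_measure_subalgebra_axioms.intro finite_measure_axioms sub)
  have XM [measurable]: "X \<in> borel_measurable M" by (rule measurable_from_subalg[OF sub X])
  note [measurable] = Z
  let ?C = "completion M" and ?B = "borel :: ('x \<times> 'e) measure"
  let ?P = "(borel :: 'x measure) \<Otimes>\<^sub>M (borel :: 'e measure)"
  have rce: "AE s in M. real_cond_exp M F (\<lambda>s. indicator B (Z s)) s = measure (\<kappa> s) B"
    if "B \<in> sets borel" for B
    using law that unfolding has_cond_law_def by blast
  have kernel: "\<kappa> \<in> measurable ?C (subprob_algebra borel)"
  proof (rule measurable_subprob_algebra)
    fix A :: "'e set" assume A: "A \<in> sets borel"
    have "(\<lambda>s. measure (\<kappa> s) A) \<in> borel_measurable ?C"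
      by (rule measurable_completion_cong_AE[OF _ rce[OF A]]) (rule borel_measurable_cond_exp2)
    then have "(\<lambda>s. ennreal (measure (\<kappa> s) A)) \<in> borel_measurable ?C" by measurable
    moreover have "ennreal (measure (\<kappa> s) A) = emeasure (\<kappa> s) A" if "s \<in> space ?C" for s
    proof -
      interpret k: prob_space "\<kappa> s" using \<kappa>(1) that by simp
      show ?thesis by (simp add: k.emeasure_eq_measure)
    qed
    ultimately show "(\<lambda>s. emeasure (\<kappa> s) A) \<in> borel_measurable ?C"
      by (rule measurable_cong[THEN iffD1, rotated]) simp
  qed (use \<kappa> in \<open>auto simp: prob_space_imp_subprob_space\<close>)
  have XC: "X \<in> borel_measurable ?C" by (rule measurable_completion[OF XM])
  have pair: "Pair x \<in> measurable (borel :: 'e measure) ?P" for x :: 'x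
    by measurable
  have pair\<kappa>: "Pair x \<in> measurable (\<kappa> s) ?P" if "s \<in> space M" for s and x :: 'x
    using pair unfolding measurable_cong_sets[OF \<kappa>(2)[OF that] refl] .
  have kernel2: "(\<lambda>s. distr (\<kappa> s) ?P (Pair (X s))) \<in> measurable ?C (subprob_algebra ?P)"
  proof (rule measurable_distr2[OF _ kernel])
    show "case_prod (\<lambda>s. Pair (X s)) \<in> measurable (?C \<Otimes>\<^sub>M borel) ?P"
      using measurable_compose[OF measurable_fst XC, of borel]
      unfolding case_prod_unfold by (rule measurable_Pair[OF _ measurable_snd])
  qed
  define J1 where "J1 = distr M ?P (\<lambda>s. (X s, Z s))"
  define J2 where "J2 = ?C \<bind> (\<lambda>s. distr (\<kappa> s) ?P (Pair (X s)))"
  have ne: "space ?C \<noteq> {}" using not_empty by simp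
  have J: "J1 = J2"
  proof (rule measure_eqI_generator_eq[OF Int_stable_pair_measure_generator[of borel borel]])
    show "sets J1 = sigma_sets UNIV {a \<times> b |a b. a \<in> sets borel \<and> b \<in> sets borel}"
      by (simp add: J1_def sets_pair_measure)
    show "sets J2 = sigma_sets UNIV {a \<times> b |a b. a \<in> sets borel \<and> b \<in> sets borel}"
      using sets_bind[OF sets_kernel[OF kernel2] ne] by (simp add: J2_def sets_pair_measure)
    show "range (\<lambda>_::nat. UNIV) \<subseteq> {a \<times> b |a b. a \<in> sets (borel :: 'x measure) \<and> b \<in> sets (borel :: 'e measure)}"
      by (auto intro!: exI[of _ UNIV])
    show "emeasure J1 UNIV \<noteq> \<infinity>" for i :: nat
    proof -
      have "emeasure J1 UNIV = emeasure M ((\<lambda>s. (X s, Z s)) -` UNIV \<inter> space M)"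
        unfolding J1_def using sets.top[of ?P]
        by (intro emeasure_distr) (auto simp: space_pair_measure)
      then show ?thesis by simp
    qed
    fix R assume "R \<in> {a \<times> b |a b. a \<in> sets (borel :: 'x measure) \<and> b \<in> sets (borel :: 'e measure)}"
    then obtain A B where R: "R = A \<times> B" and A: "A \<in> sets borel" and B: "B \<in> sets borel" by auto
    have RP: "R \<in> sets ?P" unfolding R using A B by simp
    have XA: "X -` A \<inter> space M \<in> sets F"
      using measurable_sets[OF X A] sub by (simp add: subalgebra_def)
    have "emeasure J1 R = emeasure M {s \<in> space M. X s \<in> A \<and> Z s \<in> B}"
      unfolding J1_def using RP by (subst emeasure_distr) (auto simp: R intro!: arg_cong[where f="emeasure M"])
    also have "\<dots> = ennreal (LINT s|M. indicator {s \<in> space M. X s \<in> A \<and> Z s \<in> B} s)"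
    proof -
      have "{s \<in> space M. X s \<in> A \<and> Z s \<in> B} \<in> sets M" using A B by measurable
      then show ?thesis by (simp add: emeasure_eq_measure Int_absorb2)
    qed
    also have "(LINT s|M. indicator {s \<in> space M. X s \<in> A \<and> Z s \<in> B} s)
        = (LINT s:X -` A \<inter> space M|M. indicator B (Z s))"
      unfolding set_lebesgue_integral_def by (intro Bochner_Integration.integral_cong) (auto simp: indicator_def)
    also have "\<dots> = (LINT s:X -` A \<inter> space M|M. real_cond_exp M F (\<lambda>s. indicator B (Z s)) s)"
      using B by (intro sub.real_cond_exp_intA XA integrable_const_bound[where B=1]) auto
    also have "ennreal \<dots> = (\<integral>\<^sup>+ s. indicator (X -` A \<inter> space M) s * emeasure (\<kappa> s) B \<partial>M)"
    proof -
      have XA': "X -` A \<inter> space M \<in> sets M" using A by measurable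
      have "integrable M (\<lambda>s. real_cond_exp M F (\<lambda>s. indicator B (Z s)) s)"
        using B by (intro sub.real_cond_exp_int(1) integrable_const_bound[where B=1]) auto
      then have int: "integrable M (\<lambda>s. indicator (X -` A \<inter> space M) s *\<^sub>R real_cond_exp M F (\<lambda>s. indicator B (Z s)) s)"
        using XA' by (intro integrable_mult_indicator)
      have "ennreal (LINT s:X -` A \<inter> space M|M. real_cond_exp M F (\<lambda>s. indicator B (Z s)) s)
          = (\<integral>\<^sup>+ s. ennreal (indicator (X -` A \<inter> space M) s *\<^sub>R real_cond_exp M F (\<lambda>s. indicator B (Z s)) s) \<partial>M)"
        unfolding set_lebesgue_integral_def
        by (rule nn_integral_eq_integral[OF int, symmetric])
          (use rce[OF B] in eventually_elim, simp)
      also have "\<dots> = (\<integral>\<^sup>+ s. indicator (X -` A \<inter> space M) s * emeasure (\<kappa> s) B \<partial>M)"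
      proof (rule nn_integral_cong_AE)
        show "AE s in M. ennreal (indicator (X -` A \<inter> space M) s *\<^sub>R real_cond_exp M F (\<lambda>s. indicator B (Z s)) s)
            = indicator (X -` A \<inter> space M) s * emeasure (\<kappa> s) B"
          using rce[OF B] AE_space
        proof eventually_elim
          case (elim s)
          interpret k: prob_space "\<kappa> s" using \<kappa>(1) elim by simp
          show ?case using elim by (simp add: indicator_def k.emeasure_eq_measure)
        qed
      qed
      finally show ?thesis .
    qed
    also have "\<dots> = (\<integral>\<^sup>+ s. emeasure (distr (\<kappa> s) ?P (Pair (X s))) R \<partial>?C)"
      unfolding nn_integral_completion
    proof (rule nn_integral_cong)
      fix s assume s: "s \<in> space M"
      have "space (\<kappa> s) = UNIV" using sets_eq_imp_space_eq[OF \<kappa>(2)[OF s]] by simp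
      then have "emeasure (distr (\<kappa> s) ?P (Pair (X s))) R = emeasure (\<kappa> s) (Pair (X s) -` R)"
        using emeasure_distr[OF pair\<kappa>[OF s] RP] by simp
      also have "Pair (X s) -` R = (if X s \<in> A then B else {})" unfolding R by auto
      finally show "indicator (X -` A \<inter> space M) s * emeasure (\<kappa> s) B
          = emeasure (distr (\<kappa> s) ?P (Pair (X s))) R"
        using s by (simp add: indicator_def)
    qed
    also have "\<dots> = emeasure J2 R"
      unfolding J2_def by (rule emeasure_bind[OF ne kernel2 RP, symmetric])
    finally show "emeasure J1 R = emeasure J2 R" .
  qed auto
  have "(\<integral>\<^sup>+ s. \<phi> (X s, Z s) \<partial>M) = (\<integral>\<^sup>+ z. \<phi> z \<partial>J1)"
    unfolding J1_def using \<phi> by (intro nn_integral_distr[symmetric]) measurable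
  also have "\<dots> = (\<integral>\<^sup>+ s. \<integral>\<^sup>+ z. \<phi> z \<partial>distr (\<kappa> s) ?P (Pair (X s)) \<partial>?C)"
    unfolding J J2_def by (rule nn_integral_bind[OF \<phi> kernel2])
  also have "\<dots> = (\<integral>\<^sup>+ s. \<integral>\<^sup>+ e. \<phi> (X s, e) \<partial>\<kappa> s \<partial>M)"
    unfolding nn_integral_completion
  proof (rule nn_integral_cong)
    fix s assume s: "s \<in> space M"
    show "(\<integral>\<^sup>+ z. \<phi> z \<partial>distr (\<kappa> s) ?P (Pair (X s))) = (\<integral>\<^sup>+ e. \<phi> (X s, e) \<partial>\<kappa> s)"
      by (rule nn_integral_distr[OF pair\<kappa>[OF s]]) (simp add: \<phi>)
  qed
  finally show ?thesis .
qed

lemma subalgebra_past: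
  assumes "\<And>i. i \<in> {1..n} \<Longrightarrow> P i \<in> borel_measurable M"
    and "\<And>i. i \<in> {1..<n} \<Longrightarrow> E i \<in> borel_measurable M"
  shows "subalgebra M (past M P E n)"
proof -
  let ?G = "{P i -` A \<inter> space M | i A. i \<in> {1..n} \<and> A \<in> sets borel} \<union>
      {E i -` A \<inter> space M | i A. i \<in> {1..<n} \<and> A \<in> sets borel}"
  have G: "?G \<subseteq> sets M" using assms by (auto intro: measurable_sets)
  then have "?G \<subseteq> Pow (space M)" using sets.space_closed by blast
  then show ?thesis unfolding subalgebra_def past_def
    using G by (simp add: sets.sigma_sets_subset)
qed

lemma measurable_past:
  assumes "1 \<le> n"
  shows "P n \<in> borel_measurable (past M P E n)"
proof (rule measurableI)
  let ?G = "{P i -` A \<inter> space M | i A. i \<in> {1..n} \<and> A \<in> sets borel} \<union>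
      {E i -` A \<inter> space M | i A. i \<in> {1..<n} \<and> A \<in> sets borel}"
  have Pow: "?G \<subseteq> Pow (space M)" by auto
  then have space: "space (past M P E n) = space M" unfolding past_def by simp
  fix A :: "'b set" assume "A \<in> sets borel"
  then have "P n -` A \<inter> space M \<in> ?G" using assms by auto
  then show "P n -` A \<inter> space (past M P E n) \<in> sets (past M P E n)"
    unfolding space unfolding past_def using Pow by simp
qed simp

section \<open>Second moments of the iterates\<close>

text \<open>
  Chung's lemma for step sizes of order \<open>1 / n\<close>. The bound \<open>K / n\<close> reproduces itself because
  \<open>(1 - a / n) * K / n + b / n\<^sup>2 \<le> K * (n - 1) / n\<^sup>2 \<le> K / (n + 1)\<close> as soon as \<open>b \<le> (a - 1) * K\<close>.
  This needs the factor \<open>1 - a / n\<close> to be nonnegative, so the induction starts at some \<open>N \<ge> a\<close>;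
  the earlier terms are covered by the uniform bound \<open>D\<close>.
\<close>

lemma decay_of_recursion:
  fixes r :: "nat \<Rightarrow> real"
  assumes a: "1 < a" and b: "0 \<le> b" and r: "\<And>n. 1 \<le> n \<Longrightarrow> 0 \<le> r n \<and> r n \<le> D"
    and rec: "\<And>n. 1 \<le> n \<Longrightarrow> r (n + 1) \<le> (1 - a / real n) * r n + b / (real n)\<^sup>2"
  obtains K where "0 \<le> K" "\<And>n. 1 \<le> n \<Longrightarrow> r n \<le> K / real n"
proof -
  have D: "0 \<le> D" using r[of 1] by simp
  obtain N :: nat where N: "real N \<ge> a" using real_arch_simple by blast
  then have N1: "N \<ge> 1" using a by (cases N) auto
  define K where "K = real N * D + b / (a - 1)"
  have K0: "0 \<le> K" unfolding K_def using D a b by simp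
  have Kb: "b \<le> (a - 1) * K"
  proof -
    have "b = (a - 1) * (b / (a - 1))" using a by simp
    also have "\<dots> \<le> (a - 1) * K" unfolding K_def using D a by (intro mult_left_mono) auto
    finally show ?thesis .
  qed
  have KD: "real N * D \<le> K" unfolding K_def using a b by simp
  have "r n \<le> K / real n" if "1 \<le> n" for n
  proof (cases "n \<le> N")
    case True
    have "r n * real n \<le> D * real N"
      using r[OF that] True D by (intro mult_mono) auto
    then show ?thesis using KD that by (simp add: field_simps)
  next
    case False
    have "N \<le> n" using False by simp
    then show ?thesis
    proof (induction n rule: dec_induct)
      case base
      have "r N * real N \<le> D * real N" using r[OF N1] by (intro mult_right_mono) auto
      then have "r N * real N \<le> K" using KD by (simp add: mult.commute)
      then show ?case using N1 by (simp add: field_simps)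
    next
      case (step n)
      then have n: "real n > 0" "1 \<le> n" "a \<le> real n" using N1 N by auto
      have "r (n + 1) \<le> (1 - a / real n) * r n + b / (real n)\<^sup>2" by (rule rec[OF n(2)])
      also have "(1 - a / real n) * r n \<le> (1 - a / real n) * (K / real n)"
        using n step.IH by (intro mult_left_mono) (auto simp: field_simps)
      also have "b / (real n)\<^sup>2 \<le> (a - 1) * K / (real n)\<^sup>2"
        using Kb by (intro divide_right_mono) auto
      also have "(1 - a / real n) * (K / real n) + (a - 1) * K / (real n)\<^sup>2
          = K * (real n - 1) / (real n)\<^sup>2"
        using n by (simp add: field_simps power2_eq_square)
      also have "\<dots> \<le> K / real (n + 1)"
      proof -
        have "(real n - 1) * (real n + 1) \<le> (real n)\<^sup>2"
          by (simp add: power2_eq_square algebra_simps)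
        then have "K * ((real n - 1) * (real n + 1)) \<le> K * (real n)\<^sup>2"
          using K0 by (rule mult_left_mono)
        then show ?thesis using n by (simp add: field_simps)
      qed
      finally show ?case by simp
    qed
  qed
  then show thesis using K0 that by blast
qed

text \<open>
  Expansion of the square: the cross term is controlled by the mean of the noise vector alone, and the
  last term by its second moment. Nonnegativity of the bound is recorded because the factor
  \<open>1 - 2 * \<gamma> * C\<close> may be negative.
\<close>

lemma noisy_step_second_moment:
  fixes G :: "'w \<Rightarrow> 'e::euclidean_space"
  assumes N: "prob_space N" and G: "G \<in> borel_measurable N"
    and V: "(\<integral>\<^sup>+ \<omega>. ennreal ((norm (G \<omega>))\<^sup>2) \<partial>N) \<le> ennreal V" "0 \<le> V"
    and \<gamma>: "0 \<le> \<gamma>" and drift: "w \<bullet> (LINT \<omega>|N. G \<omega>) \<le> - C * (norm w)\<^sup>2"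
  shows "(\<integral>\<^sup>+ \<omega>. ennreal ((norm (w + \<gamma> *\<^sub>R G \<omega>))\<^sup>2) \<partial>N)
      \<le> ennreal ((1 - 2 * \<gamma> * C) * (norm w)\<^sup>2 + \<gamma>\<^sup>2 * V)"
    and "0 \<le> (1 - 2 * \<gamma> * C) * (norm w)\<^sup>2 + \<gamma>\<^sup>2 * V"
proof -
  interpret prob_space N by fact
  note [measurable] = G
  have int2: "integrable N (\<lambda>\<omega>. (norm (G \<omega>))\<^sup>2)"
    using V by (intro integrableI_nonneg) (auto intro: le_less_trans)
  have int1: "integrable N G"
  proof (rule Bochner_Integration.integrable_bound)
    show "integrable N (\<lambda>\<omega>. 1 + (norm (G \<omega>))\<^sup>2)" using int2 by simp
    have "x \<le> 1 + x\<^sup>2" for x :: real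
    proof -
      have "0 \<le> (x - 1)\<^sup>2" "0 \<le> x\<^sup>2" by simp_all
      then have "0 \<le> 1 + x\<^sup>2 - 2 * x" "0 \<le> x\<^sup>2" by (simp_all add: power2_diff)
      then show ?thesis by linarith
    qed
    then show "AE \<omega> in N. norm (G \<omega>) \<le> norm (1 + (norm (G \<omega>))\<^sup>2)" by simp
  qed measurable
  have sq: "(norm (w + \<gamma> *\<^sub>R G \<omega>))\<^sup>2 = (norm w)\<^sup>2 + 2 * \<gamma> * (w \<bullet> G \<omega>) + \<gamma>\<^sup>2 * (norm (G \<omega>))\<^sup>2" for \<omega>
    unfolding power2_norm_eq_inner
    by (simp add: inner_add_left inner_add_right inner_commute power2_eq_square algebra_simps)
  have int: "integrable N (\<lambda>\<omega>. (norm (w + \<gamma> *\<^sub>R G \<omega>))\<^sup>2)"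
    unfolding sq using int1 int2 by auto
  have "(LINT \<omega>|N. (norm (w + \<gamma> *\<^sub>R G \<omega>))\<^sup>2)
      = (norm w)\<^sup>2 + 2 * \<gamma> * (w \<bullet> (LINT \<omega>|N. G \<omega>)) + \<gamma>\<^sup>2 * (LINT \<omega>|N. (norm (G \<omega>))\<^sup>2)"
    unfolding sq using int1 int2 by (simp add: prob_space)
  also have "\<dots> \<le> (norm w)\<^sup>2 + 2 * \<gamma> * (- C * (norm w)\<^sup>2) + \<gamma>\<^sup>2 * V"
  proof -
    have "ennreal (LINT \<omega>|N. (norm (G \<omega>))\<^sup>2) \<le> ennreal V"
      using V(1) nn_integral_eq_integral[OF int2] by simp
    then have "(LINT \<omega>|N. (norm (G \<omega>))\<^sup>2) \<le> V" using V(2) by simp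
    then show ?thesis using \<gamma> drift by (intro add_mono mult_left_mono) auto
  qed
  also have "\<dots> = (1 - 2 * \<gamma> * C) * (norm w)\<^sup>2 + \<gamma>\<^sup>2 * V" by (simp add: algebra_simps)
  finally have le: "(LINT \<omega>|N. (norm (w + \<gamma> *\<^sub>R G \<omega>))\<^sup>2) \<le> (1 - 2 * \<gamma> * C) * (norm w)\<^sup>2 + \<gamma>\<^sup>2 * V" .
  then show "(\<integral>\<^sup>+ \<omega>. ennreal ((norm (w + \<gamma> *\<^sub>R G \<omega>))\<^sup>2) \<partial>N)
      \<le> ennreal ((1 - 2 * \<gamma> * C) * (norm w)\<^sup>2 + \<gamma>\<^sup>2 * V)"
    using nn_integral_eq_integral[OF int] by (simp add: ennreal_leI)
  have "0 \<le> (LINT \<omega>|N. (norm (w + \<gamma> *\<^sub>R G \<omega>))\<^sup>2)" by simp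
  with le show "0 \<le> (1 - 2 * \<gamma> * C) * (norm w)\<^sup>2 + \<gamma>\<^sup>2 * V" by (rule order_trans[rotated])
qed

section \<open>Convergence of the algorithm\<close>

theorem proposition7:
  fixes \<G> :: "('w, 'k::finite, 'd::finite, 'y) game_data"
    and ustar :: "real ^ 'k \<Rightarrow> real"
    and C \<eta> :: real
    and M :: "'s measure"
    and P E :: "nat \<Rightarrow> 's \<Rightarrow> real ^ 'k"
    and p1 :: "real ^ 'k"
  assumes actions: "CARD('k) \<ge> 2"
    and game: "queueing_game \<G>"
    and A1: "\<forall>p\<in>strategies. cycle_moment 2 \<G> p < \<infinity>"
    and A2: "(SUP p\<in>strategies.
                \<integral>\<^sup>+ \<omega>. ennreal ((norm (cycle_estimator \<G> p \<omega>))\<^sup>2) \<partial>strat_prob \<G> p) < \<infinity>"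
    and A3_continuous: "continuous_on strategies (\<lambda>p. tangent_proj *v utility \<G> p)"
    and A3_gradient:
      "\<forall>p\<in>strategies. has_simplex_gradient ustar p (- (tangent_proj *v utility \<G> p))"
    and lipschitz: "locally_lipschitz_on strategies (utility \<G>)"
    and C_pos: "C > 0"
    and strongly_convex:
      "\<forall>p\<in>strategies. \<forall>q\<in>strategies.
         ustar p \<ge> ustar q - (tangent_proj *v utility \<G> q) \<bullet> (p - q) + C / 2 * (norm (p - q))\<^sup>2"
    and step_size: "\<eta> > 1 / (2 * C)"
    and algorithm_space: "prob_space M"
    and estimate_measurable: "\<forall>n\<ge>1. E n \<in> borel_measurable M"
    and start: "p1 \<in> strategies" "\<forall>\<omega>\<in>space M. P 1 \<omega> = p1"
    and iteration:
      "\<forall>n\<ge>1. \<forall>\<omega>\<in>space M.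
         P (n + 1) \<omega> = closest_point strategies (P n \<omega> + (\<eta> / real n) *\<^sub>R E n \<omega>)"
    and estimate_law:
      "\<forall>n\<ge>1. has_cond_law M (past M P E n) (E n)
         (\<lambda>\<omega>. distr (strat_prob \<G> (P n \<omega>)) borel (cycle_estimator \<G> (P n \<omega>)))"
  shows "\<exists>K. \<forall>n\<ge>1. \<forall>\<delta>\<in>{0<..<1}.
           measure M {\<omega>\<in>space M. eps_equilibrium (utility \<G>) (sqrt (real n powr - \<delta>)) (P n \<omega>)}
             \<ge> 1 - K * real n powr (\<delta> - 1)"
proof -
  interpret queueing_game \<G> by (rule game)
  interpret M: prob_space M by (rule algorithm_space)
  let ?u = "utility \<G>"
  have ne: "strategies \<noteq> ({} :: (real ^ 'k) set)" using start(1) by blast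
  have P_mem: "P n \<omega> \<in> strategies" if "1 \<le> n" "\<omega> \<in> space M" for n \<omega>
  proof (cases "n = 1")
    case True
    then show ?thesis using start that by simp
  next
    case False
    with \<open>1 \<le> n\<close> obtain m where m: "n = m + 1" "1 \<le> m" by (cases n) auto
    then have "P n \<omega> = closest_point strategies (P m \<omega> + (\<eta> / real m) *\<^sub>R E m \<omega>)"
      using iteration that by blast
    then show ?thesis using closest_point_in_set[OF closed_strategies ne] by simp
  qed
  have P_meas: "P n \<in> borel_measurable M" if "1 \<le> n" for n
    using that
  proof (induction n rule: nat_induct_at_least)
    case base
    have "(\<lambda>_. p1) \<in> borel_measurable M" by simp
    then show ?case by (rule measurable_cong[THEN iffD1, rotated]) (use start(2) in simp)
  next
    case (Suc n)
    note [measurable] = Suc.IH estimate_measurable[rule_format, OF Suc.hyps]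
    have "closest_point strategies \<in> borel_measurable (borel :: (real ^ 'k) measure)"
      by (intro borel_measurable_continuous_onI continuous_on_closest_point
        convex_strategies closed_strategies ne)
    then have "(\<lambda>\<omega>. closest_point strategies (P n \<omega> + (\<eta> / real n) *\<^sub>R E n \<omega>)) \<in> borel_measurable M"
      by (rule measurable_compose[rotated]) measurable
    then show ?case
      by (rule measurable_cong[THEN iffD1, rotated]) (use iteration Suc.hyps in simp)
  qed
  obtain V where V: "0 \<le> V" "\<And>p. p \<in> strategies \<Longrightarrow>
      (\<integral>\<^sup>+ \<omega>. ennreal ((norm (cycle_estimator \<G> p \<omega>))\<^sup>2) \<partial>strat_prob \<G> p) \<le> ennreal V"
  proof
    let ?s = "SUP p\<in>strategies. \<integral>\<^sup>+ \<omega>. ennreal ((norm (cycle_estimator \<G> p \<omega>))\<^sup>2) \<partial>strat_prob \<G> p"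
    show "0 \<le> enn2real ?s" by simp
    have "ennreal (enn2real ?s) = ?s" using A2 by (intro ennreal_enn2real) simp
    then show "(\<integral>\<^sup>+ \<omega>. ennreal ((norm (cycle_estimator \<G> p \<omega>))\<^sup>2) \<partial>strat_prob \<G> p) \<le> ennreal (enn2real ?s)"
      if "p \<in> strategies" for p using that by (auto intro: SUP_upper)
  qed
  obtain p where p: "p \<in> strategies" and opt: "\<And>q. q \<in> strategies \<Longrightarrow> ?u p \<bullet> (q - p) \<le> 0"
    and mono: "\<And>q. q \<in> strategies \<Longrightarrow> ?u q \<bullet> (q - p) \<le> - C * (norm (q - p))\<^sup>2"
    using potential_minimiser_exists[OF ne A3_continuous A3_gradient C_pos strongly_convex] by blast
  define r where "r n = (LINT \<omega>|M. (norm (P n \<omega> - p))\<^sup>2)" for n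
  have dist_meas: "(\<lambda>\<omega>. (norm (P n \<omega> - p))\<^sup>2) \<in> borel_measurable M" if "1 \<le> n" for n
    using P_meas[OF that] by measurable
  have dist_bound: "(norm (P n \<omega> - p))\<^sup>2 \<le> 4" if "1 \<le> n" "\<omega> \<in> space M" for n \<omega>
    using power_mono[OF norm_strategy_diff_le_2[OF P_mem[OF that] p] norm_ge_zero, of 2] by simp
  have dist_int: "integrable M (\<lambda>\<omega>. (norm (P n \<omega> - p))\<^sup>2)" if "1 \<le> n" for n
    using dist_meas[OF that] dist_bound[OF that] by (intro M.integrable_const_bound[where B=4]) auto
  have r_bound: "0 \<le> r n \<and> r n \<le> 4" if "1 \<le> n" for n
  proof
    show "0 \<le> r n" by (simp add: r_def)
    have "r n \<le> (LINT \<omega>|M. 4)"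
      unfolding r_def using dist_bound[OF that] by (intro integral_mono dist_int that) auto
    then show "r n \<le> 4" by (simp add: M.prob_space)
  qed
  have \<eta>: "0 < \<eta>" using step_size C_pos by (smt (verit) divide_pos_pos)
  have rec: "r (n + 1) \<le> (1 - 2 * C * \<eta> / real n) * r n + (\<eta>\<^sup>2 * V) / (real n)\<^sup>2" if n: "1 \<le> n" for n
  proof -
    let ?\<gamma> = "\<eta> / real n"
    let ?h = "\<lambda>\<omega>. (1 - 2 * ?\<gamma> * C) * (norm (P n \<omega> - p))\<^sup>2 + ?\<gamma>\<^sup>2 * V"
    let ?\<kappa> = "\<lambda>\<omega>. distr (strat_prob \<G> (P n \<omega>)) borel (cycle_estimator \<G> (P n \<omega>))"
    let ?\<phi> = "\<lambda>(q, e). ennreal ((norm ((q - p) + ?\<gamma> *\<^sub>R e))\<^sup>2)"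
    have step: "(\<integral>\<^sup>+ e. ?\<phi> (P n \<omega>, e) \<partial>?\<kappa> \<omega>) \<le> ennreal (?h \<omega>)" and nonneg: "0 \<le> ?h \<omega>"
      if \<omega>: "\<omega> \<in> space M" for \<omega>
    proof -
      let ?q = "P n \<omega>"
      have q: "?q \<in> strategies" by (rule P_mem[OF n \<omega>])
      have fin: "cycle_moment 2 \<G> ?q < \<infinity>" using A1 q by blast
      note est = cycle_estimator_mean[OF q fin]
      obtain c where c: "1 \<le> c" "(LINT \<omega>|strat_prob \<G> ?q. cycle_estimator \<G> ?q \<omega>) = c *\<^sub>R ?u ?q"
        using est(3) by blast
      \<comment> \<open>the drift \<open>?u ?q \<bullet> (?q - p)\<close> is nonpositive, so the factor \<open>c \<ge> 1\<close> only lowers it\<close>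
      have drift: "(?q - p) \<bullet> (LINT \<omega>|strat_prob \<G> ?q. cycle_estimator \<G> ?q \<omega>) \<le> - C * (norm (?q - p))\<^sup>2"
      proof -
        have le: "?u ?q \<bullet> (?q - p) \<le> - C * (norm (?q - p))\<^sup>2" by (rule mono[OF q])
        also have "\<dots> \<le> 0" using C_pos by simp
        finally have "?u ?q \<bullet> (?q - p) \<le> 0" .
        then have "c * (?u ?q \<bullet> (?q - p)) \<le> 1 * (?u ?q \<bullet> (?q - p))"
          using c(1) by (intro mult_right_mono_neg) auto
        then show ?thesis using le unfolding c(2) by (simp add: inner_commute)
      qed
      have "(\<integral>\<^sup>+ e. ?\<phi> (?q, e) \<partial>?\<kappa> \<omega>)
          = (\<integral>\<^sup>+ \<omega>'. ennreal ((norm ((?q - p) + ?\<gamma> *\<^sub>R cycle_estimator \<G> ?q \<omega>'))\<^sup>2) \<partial>strat_prob \<G> ?q)"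
        by (subst nn_integral_distr[OF est(1)]) simp_all
      also have "\<dots> \<le> ennreal (?h \<omega>)"
        using \<eta> by (intro noisy_step_second_moment(1) prob q est(1) V drift) simp
      finally show "(\<integral>\<^sup>+ e. ?\<phi> (?q, e) \<partial>?\<kappa> \<omega>) \<le> ennreal (?h \<omega>)" .
      show "0 \<le> ?h \<omega>"
        using \<eta> by (intro noisy_step_second_moment(2)[OF prob[OF q] est(1)] V q drift) simp
    qed
    \<comment> \<open>projecting onto the simplex cannot increase the distance to the strategy \<open>p\<close>\<close>
    have proj: "norm (P (n + 1) \<omega> - p) \<le> norm ((P n \<omega> - p) + ?\<gamma> *\<^sub>R E n \<omega>)"
      if \<omega>: "\<omega> \<in> space M" for \<omega>
    proof -
      have "dist (closest_point strategies (P n \<omega> + ?\<gamma> *\<^sub>R E n \<omega>)) (closest_point strategies p)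
          \<le> dist (P n \<omega> + ?\<gamma> *\<^sub>R E n \<omega>) p"
        by (rule closest_point_lipschitz[OF convex_strategies closed_strategies ne])
      moreover have "P (n + 1) \<omega> = closest_point strategies (P n \<omega> + ?\<gamma> *\<^sub>R E n \<omega>)"
        using iteration n \<omega> by blast
      ultimately show ?thesis by (simp add: closest_point_self[OF p] dist_norm algebra_simps)
    qed
    have h_int: "integrable M ?h" using dist_int[OF n] by simp
    have "ennreal (r (n + 1)) = (\<integral>\<^sup>+ \<omega>. ennreal ((norm (P (n + 1) \<omega> - p))\<^sup>2) \<partial>M)"
      unfolding r_def using dist_int[of "n + 1"] by (subst nn_integral_eq_integral) auto
    also have "\<dots> \<le> (\<integral>\<^sup>+ \<omega>. ?\<phi> (P n \<omega>, E n \<omega>) \<partial>M)"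
      by (intro nn_integral_mono) (auto intro!: ennreal_leI power_mono simp: proj[simplified])
    also have "\<dots> = (\<integral>\<^sup>+ \<omega>. \<integral>\<^sup>+ e. ?\<phi> (P n \<omega>, e) \<partial>?\<kappa> \<omega> \<partial>M)"
    proof (rule nn_integral_cond_law[OF algorithm_space])
      show "subalgebra M (past M P E n)"
        using P_meas estimate_measurable by (intro subalgebra_past) auto
      show "P n \<in> borel_measurable (past M P E n)" by (rule measurable_past[OF n])
      show "has_cond_law M (past M P E n) (E n) ?\<kappa>" using estimate_law n by blast
      show "E n \<in> borel_measurable M" using estimate_measurable n by blast
      show "prob_space (?\<kappa> \<omega>)" if "\<omega> \<in> space M" for \<omega>
      proof -
        have q: "P n \<omega> \<in> strategies" by (rule P_mem[OF n that])
        then show ?thesis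
          using A1 by (intro prob_space.prob_space_distr prob cycle_estimator_mean(1)) auto
      qed
    qed (auto intro!: measurable_compose[OF _ measurable_ennreal] simp: case_prod_beta)
    also have "\<dots> \<le> (\<integral>\<^sup>+ \<omega>. ennreal (?h \<omega>) \<partial>M)" by (intro nn_integral_mono step)
    also have "\<dots> = ennreal (LINT \<omega>|M. ?h \<omega>)"
      using nonneg by (intro nn_integral_eq_integral h_int) auto
    finally have "ennreal (r (n + 1)) \<le> ennreal (LINT \<omega>|M. ?h \<omega>)" .
    moreover have "0 \<le> (LINT \<omega>|M. ?h \<omega>)" using nonneg by (intro Bochner_Integration.integral_nonneg) auto
    ultimately have "r (n + 1) \<le> (LINT \<omega>|M. ?h \<omega>)" by simp
    also have "\<dots> = (1 - 2 * ?\<gamma> * C) * r n + ?\<gamma>\<^sup>2 * V"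
      unfolding r_def using dist_int[OF n] by (simp add: M.prob_space)
    finally show ?thesis by (simp add: power_divide mult.commute mult.left_commute)
  qed
  obtain D where D: "0 \<le> D" "\<And>n. 1 \<le> n \<Longrightarrow> r n \<le> D / real n"
  proof (rule decay_of_recursion[OF _ _ r_bound rec])
    show "1 < 2 * C * \<eta>" using step_size C_pos by (simp add: field_simps)
    show "0 \<le> \<eta>\<^sup>2 * V" using V(1) by simp
  qed auto
  obtain L where L: "0 < L" "\<And>q s. q \<in> strategies \<Longrightarrow> s \<in> strategies \<Longrightarrow>
      ?u q \<bullet> s - ?u q \<bullet> q \<le> L * norm (q - p)"
    using regret_le_distance[OF lipschitz p opt] by blast
  have u_cont: "continuous_on strategies ?u"
    by (rule locally_lipschitz_on_imp_continuous_on[OF lipschitz])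
  show ?thesis
  proof (intro exI[of _ "L\<^sup>2 * D"] allI impI ballI)
    fix n :: nat and \<delta> :: real assume n: "1 \<le> n" and \<delta>: "\<delta> \<in> {0<..<1}"
    let ?\<epsilon> = "sqrt (real n powr - \<delta>)"
    let ?good = "{\<omega> \<in> space M. eps_equilibrium ?u ?\<epsilon> (P n \<omega>)}"
    let ?t = "real n powr - \<delta> / L\<^sup>2"
    let ?far = "{\<omega> \<in> space M. ?t \<le> (norm (P n \<omega> - p))\<^sup>2}"
    have t: "0 < ?t" using n L(1) by simp
    have good_eq: "?good = P n -` {q \<in> strategies. eps_equilibrium ?u ?\<epsilon> q} \<inter> space M"
      using P_mem[OF n] by auto
    have good: "?good \<in> sets M"
      unfolding good_eq
      by (rule measurable_sets[OF P_meas[OF n] borel_closed[OF closed_eps_equilibria[OF u_cont]]])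
    have far: "?far \<in> sets M" using dist_meas[OF n] by measurable
    \<comment> \<open>a strategy that is not an approximate equilibrium has large regret, hence is far from \<open>p\<close>\<close>
    have "space M - ?good \<subseteq> ?far"
    proof
      fix \<omega> assume \<omega>: "\<omega> \<in> space M - ?good"
      then have q: "P n \<omega> \<in> strategies" using P_mem[OF n] by auto
      obtain s where s: "s \<in> strategies" "?\<epsilon> < ?u (P n \<omega>) \<bullet> s - ?u (P n \<omega>) \<bullet> P n \<omega>"
        using \<omega> eps_equilibrium_iff[OF q] by (auto simp: not_le)
      have "?\<epsilon> \<le> L * norm (P n \<omega> - p)" using s L(2)[OF q s(1)] by linarith
      then have "?\<epsilon>\<^sup>2 \<le> (L * norm (P n \<omega> - p))\<^sup>2" by (rule power_mono) simp
      then have "real n powr - \<delta> \<le> L\<^sup>2 * (norm (P n \<omega> - p))\<^sup>2" by (simp add: power_mult_distrib)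
      then show "\<omega> \<in> ?far" using \<omega> L(1) by (simp add: divide_le_eq mult.commute)
    qed
    then have "M.prob (space M - ?good) \<le> M.prob ?far" by (intro M.finite_measure_mono far)
    also have "\<dots> \<le> r n / ?t"
      unfolding r_def using t
      by (intro integral_Markov_inequality_measure[OF dist_int[OF n] sets.empty_sets]) auto
    also have "\<dots> \<le> (D / real n) / ?t" using D(2)[OF n] t by (intro divide_right_mono) auto
    also have "\<dots> = L\<^sup>2 * D * real n powr (\<delta> - 1)"
      using n L(1) by (simp add: powr_diff powr_minus field_simps)
    finally have "M.prob (space M - ?good) \<le> L\<^sup>2 * D * real n powr (\<delta> - 1)" .
    then show "1 - L\<^sup>2 * D * real n powr (\<delta> - 1) \<le> M.prob ?good"
      using M.prob_compl[OF good] by linarith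
  qed
qed

end
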